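(* The logic $MG$ is complete with respect to the class of $\Diamond$-witnessed Gödel–Kripke models. In particular, for every finite set $\Omega$ of formulas closed under subformulas, the canonical model $\mathfrak M^\Omega$ is $\Diamond$-witnessed on $\Omega$: for every $v\in W$ and every $\Diamond\varphi\in\Omega$ there is $w\in W$ with $R(v,w)\wedge e(w,\varphi)=e(v,\Diamond\varphi)$.
   Context: Standard Gödel algebra $[0,1]_G$: $a\wedge b=\min$, $a\vee b=\max$, $a\rightarrow b=1$ if $a\le b$, else $b$; $\neg a=a\rightarrow0$. Formulas are built from propositional variables and $\bot$ with $\wedge,\vee,\rightarrow,\Box,\Diamond$ ($\neg\varphi:=\varphi\rightarrow\bot$, $\top:=\neg\bot$). A Gödel–Kripke model is $\langle W,R,e\rangle$ with $W\ne\emptyset$, $R\colon W\times W\to[0,1]$, $e\colon W\times\mathrm{Var}\to[0,1]$ extended world-wise as a homomorphism into $[0,1]_G$ for propositional connectives, with $e(v,\Box\varphi)=\bigwedge_w(R(v,w)\rightarrow e(w,\varphi))$ and $e(v,\Diamond\varphi)=\bigvee_w(R(v,w)\wedge e(w,\varphi))$. A model is $\Diamond$-witnessed if for every $v$ and every $\Diamond\varphi$ there is $v'$ with $e(v,\Diamond\varphi)=R(v,v')\wedge e(v',\varphi)$. $MG$ is the Hilbert system with: axioms of Gödel–Dummett propositional logic; $\Box(\varphi\rightarrow\psi)\rightarrow(\Box\varphi\rightarrow\Box\psi)$; $\neg\neg\Box\varphi\rightarrow\Box\neg\neg\varphi$; $\Diamond(\varphi\vee\psi)\rightarrow(\Diamond\varphi\vee\Diamond\psi)$;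 $\Diamond\neg\neg\varphi\rightarrow\neg\neg\Diamond\varphi$; $\neg\Diamond\bot$; $\Diamond(\varphi\rightarrow\psi)\rightarrow(\Box\varphi\rightarrow\Diamond\psi)$; $(\Diamond\varphi\rightarrow\Box\psi)\rightarrow\Box(\varphi\rightarrow\psi)$; modus ponens; from a theorem $\varphi$ infer $\Box\varphi$; from a theorem $\varphi\rightarrow\psi$ infer $\Diamond\varphi\rightarrow\Diamond\psi$. Consequence is local: $\Gamma\vdash_{MG}\varphi$ iff $\varphi$ is derivable by modus ponens from $\Gamma$ and theorems of $MG$. A logic $L$ is complete w.r.t. a class $\mathcal C$ if $\Gamma\vdash_L\varphi$ iff for every model in $\mathcal C$ and world $v$, $e(v,\gamma)=1$ for all $\gamma\in\Gamma$ implies $e(v,\varphi)=1$. Canonical model $\mathfrak M^\Omega$ for a finite subformula-closed set $\Omega$: $W$ is the set of homomorphisms $h$ from the formula algebra into $[0,1]_G$ with $h(\theta)=1$ for every theorem $\theta$ of $MG$; $e(h,p)=h(p)$ for variables $p$; $R(h,g)=\bigwedge\{(h(\Box\varphi)\rightarrow g(\varphi))\wedge(g(\varphi)\rightarrow h(\Diamond\varphi))\colon\varphi\in\Omega\}$ (where terms with $\Box\varphi\notin\Omega$ or $\Diamond\varphi\notin\Omega$ are omitted accordingly).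
   Formalization: The set of propositional variables is taken to be countable (as is customary); with uncountably many variables completeness for arbitrary infinite sets of premises fails, since [0,1] has no strictly increasing sequence of length ω₁. *)

theory Defs
  imports Complex_Main "HOL-Library.Countable"
begin

datatype 'v form =
    PVar 'v
  | Fls                         (\<open>\<^bold>\<bottom>\<close>)
  | Conj "'v form" "'v form"    (infixr \<open>\<^bold>\<and>\<close> 65)
  | Disj "'v form" "'v form"    (infixr \<open>\<^bold>\<or>\<close> 60)
  | Imp "'v form" "'v form"     (infixr \<open>\<^bold>\<rightarrow>\<close> 55)
  | Box "'v form"               (\<open>\<^bold>\<box> _\<close> [80] 80)
  | Dia "'v form"               (\<open>\<^bold>\<diamond> _\<close> [80] 80)

abbreviation Neg :: "'v form \<Rightarrow> 'v form"  (\<open>\<^bold>\<not> _\<close> [80] 80)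
  where "\<^bold>\<not> \<phi> \<equiv> \<phi> \<^bold>\<rightarrow> \<^bold>\<bottom>"

primrec subforms :: "'v form \<Rightarrow> 'v form set" where
  "subforms (PVar p) = {PVar p}"
| "subforms \<^bold>\<bottom> = {\<^bold>\<bottom>}"
| "subforms (\<phi> \<^bold>\<and> \<psi>) = insert (\<phi> \<^bold>\<and> \<psi>) (subforms \<phi> \<union> subforms \<psi>)"
| "subforms (\<phi> \<^bold>\<or> \<psi>) = insert (\<phi> \<^bold>\<or> \<psi>) (subforms \<phi> \<union> subforms \<psi>)"
| "subforms (\<phi> \<^bold>\<rightarrow> \<psi>) = insert (\<phi> \<^bold>\<rightarrow> \<psi>) (subforms \<phi> \<union> subforms \<psi>)"
| "subforms (\<^bold>\<box> \<phi>) = insert (\<^bold>\<box> \<phi>) (subforms \<phi>)"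
| "subforms (\<^bold>\<diamond> \<phi>) = insert (\<^bold>\<diamond> \<phi>) (subforms \<phi>)"

definition subformula_closed :: "'v form set \<Rightarrow> bool" where
  "subformula_closed \<Omega> \<longleftrightarrow> (\<forall>\<phi>\<in>\<Omega>. subforms \<phi> \<subseteq> \<Omega>)"

definition gimp :: "real \<Rightarrow> real \<Rightarrow> real"  (infixr \<open>\<rightarrow>\<^sub>G\<close> 75) where
  "a \<rightarrow>\<^sub>G b = (if a \<le> b then 1 else b)"

record ('w, 'v) kripke =
  worlds :: "'w set"
  acc :: "'w \<Rightarrow> 'w \<Rightarrow> real"
  atom_val :: "'w \<Rightarrow> 'v \<Rightarrow> real"

definition godel_kripke :: "('w, 'v) kripke \<Rightarrow> bool" where
  "godel_kripke M \<longleftrightarrow>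
     worlds M \<noteq> {} \<and>
     (\<forall>v\<in>worlds M. \<forall>w\<in>worlds M. acc M v w \<in> {0..1}) \<and>
     (\<forall>v\<in>worlds M. \<forall>p. atom_val M v p \<in> {0..1})"

primrec eval_form :: "('w, 'v) kripke \<Rightarrow> 'w \<Rightarrow> 'v form \<Rightarrow> real" where
  "eval_form M v (PVar p) = atom_val M v p"
| "eval_form M v \<^bold>\<bottom> = 0"
| "eval_form M v (\<phi> \<^bold>\<and> \<psi>) = min (eval_form M v \<phi>) (eval_form M v \<psi>)"
| "eval_form M v (\<phi> \<^bold>\<or> \<psi>) = max (eval_form M v \<phi>) (eval_form M v \<psi>)"
| "eval_form M v (\<phi> \<^bold>\<rightarrow> \<psi>) = eval_form M v \<phi> \<rightarrow>\<^sub>G eval_form M v \<psi>"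
| "eval_form M v (\<^bold>\<box> \<phi>) = (INF w\<in>worlds M. acc M v w \<rightarrow>\<^sub>G eval_form M w \<phi>)"
| "eval_form M v (\<^bold>\<diamond> \<phi>) = (SUP w\<in>worlds M. min (acc M v w) (eval_form M w \<phi>))"

definition dia_witnessed_on :: "('w, 'v) kripke \<Rightarrow> 'v form set \<Rightarrow> bool" where
  "dia_witnessed_on M \<Omega> \<longleftrightarrow>
     (\<forall>v\<in>worlds M. \<forall>\<phi>. \<^bold>\<diamond> \<phi> \<in> \<Omega> \<longrightarrow>
        (\<exists>w\<in>worlds M. min (acc M v w) (eval_form M w \<phi>) = eval_form M v (\<^bold>\<diamond> \<phi>)))"

definition dia_witnessed_models :: "('w, 'v) kripke set" where
  "dia_witnessed_models = {M. godel_kripke M \<and> dia_witnessed_on M UNIV}"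

definition entails :: "('w, 'v) kripke set \<Rightarrow> 'v form set \<Rightarrow> 'v form \<Rightarrow> bool" where
  "entails C \<Gamma> \<phi> \<longleftrightarrow>
     (\<forall>M\<in>C. \<forall>v\<in>worlds M. (\<forall>\<gamma>\<in>\<Gamma>. eval_form M v \<gamma> = 1) \<longrightarrow> eval_form M v \<phi> = 1)"

text \<open>A class of models is relative to a type \<open>'w\<close> of potential worlds. Completeness for models of
  arbitrary size follows from \<open>complete_wrt\<close> at one such type together with soundness at every
  type.\<close>

definition complete_wrt ::
  "('v form set \<Rightarrow> 'v form \<Rightarrow> bool) \<Rightarrow> ('w, 'v) kripke set \<Rightarrow> bool" where
  "complete_wrt L C \<longleftrightarrow> (\<forall>\<Gamma> \<phi>. L \<Gamma> \<phi> \<longleftrightarrow> entails C \<Gamma> \<phi>)"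

text \<open>Goedel--Dummett logic is axiomatized as intuitionistic propositional logic plus
  prelinearity.\<close>

inductive godel_axiom :: "'v form \<Rightarrow> bool" where
  "godel_axiom (\<phi> \<^bold>\<rightarrow> \<psi> \<^bold>\<rightarrow> \<phi>)"
| "godel_axiom ((\<phi> \<^bold>\<rightarrow> \<psi> \<^bold>\<rightarrow> \<chi>) \<^bold>\<rightarrow> (\<phi> \<^bold>\<rightarrow> \<psi>) \<^bold>\<rightarrow> \<phi> \<^bold>\<rightarrow> \<chi>)"
| "godel_axiom (\<phi> \<^bold>\<and> \<psi> \<^bold>\<rightarrow> \<phi>)"
| "godel_axiom (\<phi> \<^bold>\<and> \<psi> \<^bold>\<rightarrow> \<psi>)"
| "godel_axiom (\<phi> \<^bold>\<rightarrow> \<psi> \<^bold>\<rightarrow> \<phi> \<^bold>\<and> \<psi>)"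
| "godel_axiom (\<phi> \<^bold>\<rightarrow> \<phi> \<^bold>\<or> \<psi>)"
| "godel_axiom (\<psi> \<^bold>\<rightarrow> \<phi> \<^bold>\<or> \<psi>)"
| "godel_axiom ((\<phi> \<^bold>\<rightarrow> \<chi>) \<^bold>\<rightarrow> (\<psi> \<^bold>\<rightarrow> \<chi>) \<^bold>\<rightarrow> \<phi> \<^bold>\<or> \<psi> \<^bold>\<rightarrow> \<chi>)"
| "godel_axiom (\<^bold>\<bottom> \<^bold>\<rightarrow> \<phi>)"
| "godel_axiom ((\<phi> \<^bold>\<rightarrow> \<psi>) \<^bold>\<or> (\<psi> \<^bold>\<rightarrow> \<phi>))"

inductive MG_theorem :: "'v form \<Rightarrow> bool" where
  Godel: "godel_axiom \<phi> \<Longrightarrow> MG_theorem \<phi>"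
| K_Box: "MG_theorem (\<^bold>\<box> (\<phi> \<^bold>\<rightarrow> \<psi>) \<^bold>\<rightarrow> (\<^bold>\<box> \<phi> \<^bold>\<rightarrow> \<^bold>\<box> \<psi>))"
| Z_Box: "MG_theorem (\<^bold>\<not> \<^bold>\<not> \<^bold>\<box> \<phi> \<^bold>\<rightarrow> \<^bold>\<box> \<^bold>\<not> \<^bold>\<not> \<phi>)"
| D_Dia: "MG_theorem (\<^bold>\<diamond> (\<phi> \<^bold>\<or> \<psi>) \<^bold>\<rightarrow> \<^bold>\<diamond> \<phi> \<^bold>\<or> \<^bold>\<diamond> \<psi>)"
| Z_Dia: "MG_theorem (\<^bold>\<diamond> \<^bold>\<not> \<^bold>\<not> \<phi> \<^bold>\<rightarrow> \<^bold>\<not> \<^bold>\<not> \<^bold>\<diamond> \<phi>)"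
| F_Dia: "MG_theorem (\<^bold>\<not> \<^bold>\<diamond> \<^bold>\<bottom>)"
| FS1: "MG_theorem (\<^bold>\<diamond> (\<phi> \<^bold>\<rightarrow> \<psi>) \<^bold>\<rightarrow> (\<^bold>\<box> \<phi> \<^bold>\<rightarrow> \<^bold>\<diamond> \<psi>))"
| FS2: "MG_theorem ((\<^bold>\<diamond> \<phi> \<^bold>\<rightarrow> \<^bold>\<box> \<psi>) \<^bold>\<rightarrow> \<^bold>\<box> (\<phi> \<^bold>\<rightarrow> \<psi>))"
| MP: "MG_theorem (\<phi> \<^bold>\<rightarrow> \<psi>) \<Longrightarrow> MG_theorem \<phi> \<Longrightarrow> MG_theorem \<psi>"
| Nec_Box: "MG_theorem \<phi> \<Longrightarrow> MG_theorem (\<^bold>\<box> \<phi>)"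
| Mono_Dia: "MG_theorem (\<phi> \<^bold>\<rightarrow> \<psi>) \<Longrightarrow> MG_theorem (\<^bold>\<diamond> \<phi> \<^bold>\<rightarrow> \<^bold>\<diamond> \<psi>)"

inductive MG_derives :: "'v form set \<Rightarrow> 'v form \<Rightarrow> bool" for \<Gamma> :: "'v form set" where
  Assm: "\<phi> \<in> \<Gamma> \<Longrightarrow> MG_derives \<Gamma> \<phi>"
| Thm: "MG_theorem \<phi> \<Longrightarrow> MG_derives \<Gamma> \<phi>"
| MP: "MG_derives \<Gamma> (\<phi> \<^bold>\<rightarrow> \<psi>) \<Longrightarrow> MG_derives \<Gamma> \<phi> \<Longrightarrow> MG_derives \<Gamma> \<psi>"

text \<open>Homomorphisms for the propositional connectives only: formulas with a modality in
  front behave like further generators.\<close>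

definition godel_hom :: "('v form \<Rightarrow> real) \<Rightarrow> bool" where
  "godel_hom h \<longleftrightarrow>
     (\<forall>\<phi>. h \<phi> \<in> {0..1}) \<and>
     h \<^bold>\<bottom> = 0 \<and>
     (\<forall>\<phi> \<psi>. h (\<phi> \<^bold>\<and> \<psi>) = min (h \<phi>) (h \<psi>)) \<and>
     (\<forall>\<phi> \<psi>. h (\<phi> \<^bold>\<or> \<psi>) = max (h \<phi>) (h \<psi>)) \<and>
     (\<forall>\<phi> \<psi>. h (\<phi> \<^bold>\<rightarrow> \<psi>) = h \<phi> \<rightarrow>\<^sub>G h \<psi>)"

definition canonical_acc ::
  "'v form set \<Rightarrow> ('v form \<Rightarrow> real) \<Rightarrow> ('v form \<Rightarrow> real) \<Rightarrow> real" where
  \<comment> \<open>Inserting 1 makes \<open>Inf\<close> on the reals agree with the infimum in the unit interval,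
     also for the empty set.\<close>
  "canonical_acc \<Omega> h g =
     Inf (insert 1
       ({h (\<^bold>\<box> \<phi>) \<rightarrow>\<^sub>G g \<phi> | \<phi>. \<phi> \<in> \<Omega> \<and> \<^bold>\<box> \<phi> \<in> \<Omega>} \<union>
        {g \<phi> \<rightarrow>\<^sub>G h (\<^bold>\<diamond> \<phi>) | \<phi>. \<phi> \<in> \<Omega> \<and> \<^bold>\<diamond> \<phi> \<in> \<Omega>}))"

definition canonical_model :: "'v form set \<Rightarrow> ('v form \<Rightarrow> real, 'v) kripke" where
  "canonical_model \<Omega> =
     \<lparr> worlds = {h. godel_hom h \<and> (\<forall>\<theta>. MG_theorem \<theta> \<longrightarrow> h \<theta> = 1)},
       acc = canonical_acc \<Omega>,
       atom_val = (\<lambda>h p. h (PVar p)) \<rparr>"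

end

theory Submission
  imports Defs "HOL-Library.Diagonal_Subsequence" "HOL-Library.Infinite_Set"
begin

text \<open>Let \<open>v\<close> be a homomorphism that is 1 on the theorems of MG. To find a successor of \<open>v\<close> that
  witnesses \<open>\<^bold>\<diamond> \<phi>\<close>, or that brings \<open>\<^bold>\<box> \<phi>\<close> close to its value, separate a theory from a set of
  formulas closed under disjunction; this gives a homomorphism \<open>u\<close> that is correct up to the
  choice of scale. The Fischer Servi axioms say exactly that \<open>u\<close> orders formulas compatibly with
  the values of \<open>v\<close> at boxed and diamond formulas, so for finitely many constraints a strictly
  increasing rescaling of \<open>[0, 1]\<close> turns \<open>u\<close> into the required successor. This makes the canonical
  model \<open>\<^bold>\<diamond>\<close>-witnessed.

  For completeness with infinitely many premises and witnesses for all diamond formulas, name the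
  worlds of a tree of requirements by finite terms and interpret the names by successors that are
  correct on a finite set of formulas. As the finite set grows, a diagonal subsequence decides all
  comparisons between named truth values. The limit is a total preorder on a countable set, which
  embeds into \<open>[0, 1]\<close> by \<open>x \<mapsto> \<Sum>{2\<^sup>-\<^sup>n | the n-th element is \<le> x}\<close> (normalised). This embedding
  preserves infima, which is what \<open>\<^bold>\<box>\<close> needs; \<open>\<^bold>\<diamond>\<close> only needs its witnesses.\<close>

section \<open>Countable preorders and rescalings of the unit interval\<close>

text \<open>The last conclusion is what makes infima survive: elements that get below every
  \<open>y\<close> strictly above \<open>x\<close> have values that get below every
  \<open>c > f x\<close>. An arbitrary order embedding could leave a gap directly above the value of
  an infimum.\<close>

lemma countable_preorder_embedding:
  fixes le :: "'x::countable \<Rightarrow> 'x \<Rightarrow> bool"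
  assumes total: "\<And>x y. le x y \<or> le y x"
    and trans: "\<And>x y z. le x y \<Longrightarrow> le y z \<Longrightarrow> le x z"
    and bot: "\<And>x. le b x" and top: "\<And>x. le x t" and nontrivial: "\<not> le t b"
  obtains f :: "'x \<Rightarrow> real" where
    "\<And>x. f x \<in> {0..1}" "f b = 0" "f t = 1" "\<And>x y. f x \<le> f y \<longleftrightarrow> le x y"
    "\<And>x c. f x < c \<Longrightarrow> f x < 1 \<Longrightarrow> \<exists>y. f x < f y \<and> (\<forall>s. f s < f y \<longrightarrow> f s < c)"
proof -
  \<comment> \<open>The elements equivalent to \<open>b\<close> are left out so that the sum at
    \<open>b\<close> is 0. \<open>from_nat\<close> may repeat elements, which does not disturb
    monotonicity.\<close>
  define a where "a x n = (if le (from_nat n) x \<and> \<not> le (from_nat n) b then (1/2::real)^n else 0)"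
    for x n
  define g where "g x = suminf (a x)" for x
  have geo: "summable (\<lambda>n. (1/2::real)^n)" by (rule summable_geometric) simp
  have a_bounds: "0 \<le> a x n" "a x n \<le> (1/2)^n" for x n by (auto simp: a_def)
  have sm: "summable (a x)" for x
    by (rule summable_comparison_test'[OF geo, of 0]) (use a_bounds in auto)
  have refl: "le x x" for x using total by blast
  have g_mono: "g x \<le> g y" if "le x y" for x y
    unfolding g_def by (rule suminf_le[OF _ sm sm]) (use that trans in \<open>auto simp: a_def\<close>)
  have g_strict: "g x < g y" if n: "\<not> le y x" for x y
  proof -
    have xy: "le x y" using total n by blast
    let ?d = "\<lambda>n. a y n - a x n"
    have d0: "0 \<le> ?d n" for n using trans xy by (auto simp: a_def)
    have "sum ?d {to_nat y} \<le> suminf ?d"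
      by (rule sum_le_suminf[OF summable_diff[OF sm sm]]) (use d0 in auto)
    moreover have "suminf ?d = g y - g x" unfolding g_def by (rule suminf_diff[OF sm sm, symmetric])
    moreover have "0 < ?d (to_nat y)"
      using n refl[of y] trans[OF _ bot[of x], of y] by (auto simp: a_def)
    ultimately show ?thesis by simp
  qed
  have g_iff: "g x \<le> g y \<longleftrightarrow> le x y" for x y
    using g_mono g_strict by (meson not_le)
  have "a b = (\<lambda>_. 0)" by (auto simp: a_def)
  then have gb: "g b = 0" by (simp add: g_def)
  have gt: "0 < g t" using g_strict[OF nontrivial] gb by simp
  define f where "f x = g x / g t" for x
  have f_iff: "f x \<le> f y \<longleftrightarrow> le x y" for x y
    using gt by (simp add: f_def divide_le_cancel g_iff)
  show thesis
  proof (rule that[of f])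
    have "0 \<le> g x" "g x \<le> g t" for x using g_mono[OF bot[of x]] g_mono[OF top[of x]] gb by auto
    then show "f x \<in> {0..1}" for x using gt by (simp add: f_def)
    show "f b = 0" "f t = 1" using gb gt by (auto simp: f_def)
    show "f x \<le> f y \<longleftrightarrow> le x y" for x y by (rule f_iff)
    fix x c assume xc: "f x < c" and x1: "f x < 1"
    have d: "0 < (c - f x) * g t" using xc gt by simp
    obtain N where N: "\<And>n. n \<ge> N \<Longrightarrow> norm (\<Sum>i. (1/2::real) ^ (i + n)) < (c - f x) * g t"
      using suminf_exist_split[OF d geo] by blast
    \<comment> \<open>\<open>A\<close> collects the elements not below \<open>x\<close> among the
      first \<open>N\<close> enumerated ones, with \<open>t\<close> added to make it nonempty.
      Anything strictly below its least member \<open>y\<close> can exceed \<open>x\<close> only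
      through terms of index at least \<open>N\<close>, whose sum is less than the room left by
      \<open>c\<close>.\<close>
    define A where "A = insert t {y \<in> from_nat ` {..<N}. \<not> le y x}"
    define y where "y = arg_min_on f A"
    have A: "finite A" "A \<noteq> {}" by (auto simp: A_def)
    have ntx: "\<not> le t x" using x1 f_iff[of t x] \<open>f t = 1\<close> by auto
    have yA: "y \<in> A" unfolding y_def by (rule arg_min_if_finite(1)[OF A])
    have ymin: "f y \<le> f z" if "z \<in> A" for z unfolding y_def by (rule arg_min_least[OF A that])
    have nyx: "\<not> le y x" using yA ntx by (auto simp: A_def)
    show "\<exists>y. f x < f y \<and> (\<forall>s. f s < f y \<longrightarrow> f s < c)"
    proof (intro exI[of _ y] conjI allI impI)
      show "f x < f y" using nyx f_iff[of y x] by linarith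
      fix s assume s: "f s < f y"
      let ?e = "\<lambda>n. if n < N then 0 else (1/2::real)^n"
      have se: "summable ?e"
        by (rule summable_comparison_test'[OF geo, of 0]) auto
      have "a s n \<le> a x n + ?e n" for n
      proof (cases "n < N \<and> \<not> le (from_nat n) x")
        case True
        then have "from_nat n \<in> A" by (auto simp: A_def)
        then have "\<not> le (from_nat n) s" using ymin[of "from_nat n"] s f_iff[of "from_nat n" s] by linarith
        then show ?thesis using a_bounds by (auto simp: a_def)
      next
        case False
        then show ?thesis using a_bounds[of s n] a_bounds[of x n] by (auto simp: a_def)
      qed
      then have "g s \<le> g x + suminf ?e"
        unfolding g_def suminf_add[OF sm se] by (intro suminf_le sm summable_add se)
      also have "suminf ?e = (\<Sum>i. (1/2) ^ (i + N))"
        using suminf_split_initial_segment[OF se, of N] by simp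
      also have "\<dots> < (c - f x) * g t" using N[of N] by simp
      finally have "g s < g x + (c - f x) * g t" by simp
      also have "\<dots> = c * g t" using gt by (simp add: f_def field_simps)
      finally show "f s < c" using gt by (simp add: f_def field_simps)
    qed
  qed
qed

section \<open>Limits of orders along a diagonal subsequence\<close>

text \<open>Along any subsequence, \<open>Q n\<close> or its negation holds infinitely often, so
  each \<open>Q n\<close> can be made constant by refinement; the diagonal handles all
  \<open>n\<close> at once.\<close>

lemma subsequence_deciding_predicates:
  fixes Q :: "nat \<Rightarrow> nat \<Rightarrow> bool"
  obtains r :: "nat \<Rightarrow> nat" where "strict_mono r"
    "\<And>n. eventually (\<lambda>k. Q n (r k)) sequentially \<or> eventually (\<lambda>k. \<not> Q n (r k)) sequentially"
proof -
  define P where "P n s \<longleftrightarrow> (\<forall>k. Q n (s k)) \<or> (\<forall>k. \<not> Q n (s k))" for n and s :: "nat \<Rightarrow> nat"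
  interpret subseqs P
  proof
    fix n :: nat and s :: "nat \<Rightarrow> nat" assume "strict_mono s"
    have "infinite {k. Q n (s k)} \<or> infinite {k. \<not> Q n (s k)}"
      using finite_Un[of "{k. Q n (s k)}" "{k. \<not> Q n (s k)}"] infinite_UNIV_nat
      by (auto simp: Un_def)
    then obtain A where A: "infinite A" "A = {k. Q n (s k)} \<or> A = {k. \<not> Q n (s k)}" by blast
    have "P n (s \<circ> enumerate A)"
      using enumerate_in_set[OF A(1)] A(2) by (auto simp: P_def)
    then show "\<exists>r'. strict_mono r' \<and> P n (s \<circ> r')"
      using strict_mono_enumerate[OF A(1)] by blast
  qed
  show thesis
  proof (rule that[OF subseq_diagseq])
    fix n
    \<comment> \<open>The diagonal sequence is guaranteed to be a subsequence of the
      \<open>n\<close>-th refinement from index \<open>Suc n\<close> on, hence the shift and the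
      eventual form of the claim.\<close>
    have "P n (diagseq \<circ> (+) (Suc n))"
      by (rule diagseq_holds) (auto simp: P_def)
    then have "(\<forall>k. Q n (diagseq (k + Suc n))) \<or> (\<forall>k. \<not> Q n (diagseq (k + Suc n)))"
      by (simp add: P_def add.commute)
    then show "eventually (\<lambda>k. Q n (diagseq k)) sequentially \<or>
        eventually (\<lambda>k. \<not> Q n (diagseq k)) sequentially"
      unfolding eventually_sequentially by (metis le_add_diff_inverse2)
  qed
qed

text \<open>The values \<open>h k x\<close> need not converge, and a limit of values could turn a
  strict inequality into an equality. So the limit is taken of the orders that the
  \<open>h k\<close> induce; every finite pattern of comparisons in the limit occurs at arbitrarily
  late stages \<open>k\<close>.\<close>

lemma order_limit:
  fixes h :: "nat \<Rightarrow> 'x::countable \<Rightarrow> real"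
  assumes range: "\<And>k x. h k x \<in> {0..1}" and bot: "\<And>k. h k b = 0" and top: "\<And>k. h k t = 1"
  obtains f :: "'x \<Rightarrow> real" where
    "\<And>x. f x \<in> {0..1}" "f b = 0" "f t = 1"
    "\<And>Y K. finite Y \<Longrightarrow> \<exists>k\<ge>K. \<forall>x\<in>Y. \<forall>y\<in>Y. f x \<le> f y \<longleftrightarrow> h k x \<le> h k y"
    "\<And>x c. f x < c \<Longrightarrow> f x < 1 \<Longrightarrow> \<exists>y. f x < f y \<and> (\<forall>s. f s < f y \<longrightarrow> f s < c)"
proof -
  define Q where "Q n k = (case from_nat n of (x, y) \<Rightarrow> h k x \<le> h k y)" for n k
  obtain r where r: "strict_mono r"
    and dec: "\<And>n. eventually (\<lambda>k. Q n (r k)) sequentially \<or>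
      eventually (\<lambda>k. \<not> Q n (r k)) sequentially"
    using subsequence_deciding_predicates by blast
  define le where "le x y \<longleftrightarrow> eventually (\<lambda>k. h (r k) x \<le> h (r k) y) sequentially" for x y
  have not_le: "eventually (\<lambda>k. \<not> h (r k) x \<le> h (r k) y) sequentially" if "\<not> le x y" for x y
    using dec[of "to_nat (x, y)"] that by (simp add: Q_def le_def)
  have ev: "eventually (\<lambda>k. le x y \<longleftrightarrow> h (r k) x \<le> h (r k) y) sequentially" for x y
    using not_le[of x y] by (cases "le x y") (auto simp: le_def elim: eventually_mono)
  have 1: "le x y \<or> le y x" for x y
  proof (rule disjCI)
    assume "\<not> le y x"
    from not_le[OF this] show "le x y" unfolding le_def by eventually_elim auto
  qed
  have 2: "le x z" if "le x y" "le y z" for x y z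
    using that unfolding le_def by eventually_elim auto
  have 3: "le b x" "le x t" for x using range bot top by (auto simp: le_def)
  have 4: "\<not> le t b" using bot top by (simp add: le_def)
  show thesis
  proof (rule countable_preorder_embedding[of le b t, OF 1 _ 3 4])
    show "le x z" if "le x y" "le y z" for x y z using 2 that .
    fix f :: "'x \<Rightarrow> real"
    assume f: "\<And>x. f x \<in> {0..1}" "f b = 0" "f t = 1" "\<And>x y. f x \<le> f y \<longleftrightarrow> le x y"
      "\<And>x c. f x < c \<Longrightarrow> f x < 1 \<Longrightarrow> \<exists>y. f x < f y \<and> (\<forall>s. f s < f y \<longrightarrow> f s < c)"
    show thesis
    proof (rule that[OF f(1-3) _ f(5)])
    fix Y :: "'x set" and K :: nat assume "finite Y"
    then have "eventually (\<lambda>k. \<forall>x\<in>Y. \<forall>y\<in>Y. le x y \<longleftrightarrow> h (r k) x \<le> h (r k) y) sequentially"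
      by (simp add: eventually_ball_finite_distrib ev)
    then obtain k0 where "\<forall>k\<ge>k0. \<forall>x\<in>Y. \<forall>y\<in>Y. le x y \<longleftrightarrow> h (r k) x \<le> h (r k) y"
      by (auto simp: eventually_sequentially)
    moreover have "r (max k0 K) \<ge> K" using seq_suble[OF r, of "max k0 K"] by linarith
    ultimately show "\<exists>k\<ge>K. \<forall>x\<in>Y. \<forall>y\<in>Y. f x \<le> f y \<longleftrightarrow> h k x \<le> h k y"
      using f(4) by (meson max.cobounded1)
    qed assumption+
  qed
qed

text \<open>\<open>L\<close> and \<open>U\<close> are the best lower and upper bounds that monotonicity
  extracts from the constraints, and \<open>(1 - r) L r + r U r\<close> is strictly increasing although
  neither \<open>L\<close> nor \<open>U\<close> need be.\<close>

lemma strict_mono_interpolation: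
  fixes P Q :: "(real \<times> real) set"
  assumes fin: "finite P" "finite Q"
    and P01: "(0, 0) \<in> P" "(1, 1) \<in> P" and Q01: "(0, 0) \<in> Q" "(1, 1) \<in> Q"
    and sep: "\<And>s l t u. (s, l) \<in> P \<Longrightarrow> (t, u) \<in> Q \<Longrightarrow> u < l \<Longrightarrow> t < s"
    and sep': "\<And>s l t u. (s, l) \<in> P \<Longrightarrow> (t, u) \<in> Q \<Longrightarrow> u \<le> l \<Longrightarrow> t \<le> s"
  obtains g :: "real \<Rightarrow> real" where "strict_mono_on {0..1} g" "g 0 = 0" "g 1 = 1"
    "\<And>s l. s \<in> {0..1} \<Longrightarrow> (s, l) \<in> P \<Longrightarrow> l \<le> g s" "\<And>t u. t \<in> {0..1} \<Longrightarrow> (t, u) \<in> Q \<Longrightarrow> g t \<le> u"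
proof -
  define A where "A r = snd ` {p \<in> P. fst p \<le> r}" for r
  define B where "B r = snd ` {q \<in> Q. r \<le> fst q}" for r
  define L where "L r = Max (A r)" for r
  define U where "U r = Min (B r)" for r
  have fin: "finite (A r)" "finite (B r)" for r using fin by (auto simp: A_def B_def)
  have A0: "0 \<in> A r" if "0 \<le> r" for r using that P01 by (force simp: A_def)
  have B1: "1 \<in> B r" if "r \<le> 1" for r using that Q01 by (force simp: B_def)
  have L_mem: "\<exists>s\<le>r. (s, L r) \<in> P" if "0 \<le> r" for r
  proof -
    have "L r \<in> A r" unfolding L_def using Max_in[OF fin(1)] A0[OF that] by blast
    then show ?thesis by (auto simp: A_def)
  qed
  have U_mem: "\<exists>t\<ge>r. (t, U r) \<in> Q" if "r \<le> 1" for r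
  proof -
    have "U r \<in> B r" unfolding U_def using Min_in[OF fin(2)] B1[OF that] by blast
    then show ?thesis by (auto simp: B_def)
  qed
  have L_mono: "L r \<le> L r'" if "0 \<le> r" "r \<le> r'" for r r'
    unfolding L_def
    by (rule Max_mono[OF _ _ fin(1)]) (use that A0[of r] in \<open>auto simp: A_def\<close>)
  have U_mono: "U r \<le> U r'" if "r \<le> r'" "r' \<le> 1" for r r'
    unfolding U_def
    by (rule Min_antimono[OF _ _ fin(2)]) (use that B1[of r'] in \<open>auto simp: B_def\<close>)
  have LU: "L r \<le> U r" if r: "0 \<le> r" "r \<le> 1" for r
  proof -
    obtain s t where "s \<le> r" "(s, L r) \<in> P" "r \<le> t" "(t, U r) \<in> Q"
      using L_mem[OF r(1)] U_mem[OF r(2)] by blast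
    then show ?thesis using sep[of s "L r" t "U r"] by linarith
  qed
  \<comment> \<open>Strictness across different arguments comes from \<open>sep'\<close>: were
    \<open>U r' \<le> L r\<close>, a point of \<open>Q\<close> at or beyond \<open>r'\<close> would
    lie at or before a point of \<open>P\<close> at or below \<open>r\<close>.\<close>
  have LU_strict: "L r < U r'" if r: "0 \<le> r" "r < r'" "r' \<le> 1" for r r'
  proof -
    obtain s t where "s \<le> r" "(s, L r) \<in> P" "r' \<le> t" "(t, U r') \<in> Q"
      using L_mem[OF r(1)] U_mem[OF r(3)] by blast
    then show ?thesis using sep'[of s "L r" t "U r'"] r(2) by linarith
  qed
  define g where "g r = (1 - r) * L r + r * U r" for r
  have Lg: "L r \<le> g r" and gU: "g r \<le> U r" if "0 \<le> r" "r \<le> 1" for r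
  proof -
    have "g r - L r = r * (U r - L r)" "U r - g r = (1 - r) * (U r - L r)"
      by (auto simp: g_def algebra_simps)
    moreover have "0 \<le> r * (U r - L r)" "0 \<le> (1 - r) * (U r - L r)" using LU that by auto
    ultimately show "L r \<le> g r" "g r \<le> U r" by (metis diff_ge_0_iff_ge)+
  qed
  have lower: "l \<le> g s" if "s \<in> {0..1}" "(s, l) \<in> P" for s l
  proof -
    have "l \<le> L s" unfolding L_def by (rule Max_ge[OF fin(1)]) (use that in \<open>force simp: A_def\<close>)
    then show ?thesis using Lg[of s] that by auto
  qed
  have upper: "g t \<le> u" if "t \<in> {0..1}" "(t, u) \<in> Q" for t u
  proof -
    have "U t \<le> u" unfolding U_def by (rule Min_le[OF fin(2)]) (use that in \<open>force simp: B_def\<close>)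
    then show ?thesis using gU[of t] that by auto
  qed
  show thesis
  proof (rule that[of g])
    show "strict_mono_on {0..1} g"
    proof (rule strict_mono_onI)
      fix r s :: real assume rs: "r \<in> {0..1}" "s \<in> {0..1}" "r < s"
      have a: "(1 - r) * L r \<le> (1 - r) * L s" "r * U r \<le> r * U s"
        using rs L_mono[of r s] U_mono[of r s] by (auto intro!: mult_left_mono)
      have b: "g s - ((1 - r) * L s + r * U s) = (s - r) * (U s - L s)"
        by (simp add: g_def algebra_simps)
      show "g r < g s"
      \<comment> \<open>If there is room between \<open>L s\<close> and \<open>U s\<close>, the
        growing weight of \<open>U\<close> gives the strict increase. Otherwise
        \<open>L s = U s\<close>, and \<open>LU_strict\<close> makes \<open>L\<close> itself
        increase from \<open>r\<close> to \<open>s\<close>.\<close>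
      proof (cases "L s < U s")
        case True
        then have "0 < (s - r) * (U s - L s)" using rs by simp
        then show ?thesis using a b by (simp add: g_def)
      next
        case False
        then have "L s = U s" using LU[of s] rs by auto
        then have "L r < L s" using LU_strict[of r s] rs by auto
        then have "(1 - r) * L r < (1 - r) * L s" using rs by auto
        then show ?thesis using a b \<open>L s = U s\<close> by (simp add: g_def)
      qed
    qed
    show "g 0 = 0" using lower[of 0 0] upper[of 0 0] P01 Q01 by auto
    show "g 1 = 1" using lower[of 1 1] upper[of 1 1] P01 Q01 by auto
  qed (use lower upper in auto)
qed

section \<open>Soundness\<close>

lemma gimp_in_unit: "b \<in> {0..1} \<Longrightarrow> a \<rightarrow>\<^sub>G b \<in> {0..1}"
  by (simp add: gimp_def)

text \<open>Residuation: Goedel implication is adjoint to the minimum. It reduces the modal axioms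
  to inequalities between minima that are checked one world at a time.\<close>

lemma le_gimp_iff: "c \<le> 1 \<Longrightarrow> c \<le> a \<rightarrow>\<^sub>G b \<longleftrightarrow> min c a \<le> b"
  by (auto simp: gimp_def min_def)

lemma gimp_eq_1_iff: "a \<le> 1 \<Longrightarrow> a \<rightarrow>\<^sub>G b = 1 \<longleftrightarrow> a \<le> b"
  by (auto simp: gimp_def)

context
  fixes M :: "('w, 'v) kripke"
  assumes M: "godel_kripke M"
begin

lemma eval_form_in_unit: "v \<in> worlds M \<Longrightarrow> eval_form M v \<phi> \<in> {0..1}"
proof (induction \<phi> arbitrary: v)
  case (Box \<phi>)
  have ne: "worlds M \<noteq> {}" using Box by blast
  have t: "acc M v w \<rightarrow>\<^sub>G eval_form M w \<phi> \<in> {0..1}" if "w \<in> worlds M" for w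
    using Box.IH that gimp_in_unit by blast
  have "0 \<le> (INF w\<in>worlds M. acc M v w \<rightarrow>\<^sub>G eval_form M w \<phi>)"
    using t by (intro cINF_greatest[OF ne]) auto
  moreover have "(INF w\<in>worlds M. acc M v w \<rightarrow>\<^sub>G eval_form M w \<phi>) \<le> 1"
    using t Box.prems by (intro cINF_lower2[OF _ Box.prems] bdd_belowI2[where m = 0]) auto
  ultimately show ?case by simp
next
  case (Dia \<phi>)
  have ne: "worlds M \<noteq> {}" using Dia by blast
  have t: "min (acc M v w) (eval_form M w \<phi>) \<in> {0..1}" if "w \<in> worlds M" for w
    using Dia.IH[OF that] M Dia.prems that by (auto simp: godel_kripke_def min_def)
  have "(SUP w\<in>worlds M. min (acc M v w) (eval_form M w \<phi>)) \<le> 1"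
    using t by (intro cSUP_least[OF ne]) auto
  moreover have "0 \<le> (SUP w\<in>worlds M. min (acc M v w) (eval_form M w \<phi>))"
    using t Dia.prems by (intro cSUP_upper2[OF _ Dia.prems] bdd_aboveI2[where M = 1]) auto
  ultimately show ?case by simp
qed (use M in \<open>auto simp: godel_kripke_def gimp_def min_def max_def\<close>)

lemma eval_form_bounds: "v \<in> worlds M \<Longrightarrow> 0 \<le> eval_form M v \<phi>" "v \<in> worlds M \<Longrightarrow> eval_form M v \<phi> \<le> 1"
  using eval_form_in_unit by force+

lemma eval_form_Box_iff:
  assumes v: "v \<in> worlds M" and c: "c \<le> 1"
  shows "c \<le> eval_form M v (\<^bold>\<box> \<phi>) \<longleftrightarrow> (\<forall>w\<in>worlds M. min c (acc M v w) \<le> eval_form M w \<phi>)"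
proof -
  have "bdd_below ((\<lambda>w. acc M v w \<rightarrow>\<^sub>G eval_form M w \<phi>) ` worlds M)"
    by (rule bdd_belowI2[where m = 0]) (simp add: gimp_def eval_form_bounds)
  then have "c \<le> eval_form M v (\<^bold>\<box> \<phi>) \<longleftrightarrow> (\<forall>w\<in>worlds M. c \<le> acc M v w \<rightarrow>\<^sub>G eval_form M w \<phi>)"
    using v le_cINF_iff[of "worlds M" "\<lambda>w. acc M v w \<rightarrow>\<^sub>G eval_form M w \<phi>" c] by auto
  then show ?thesis using le_gimp_iff[OF c] by simp
qed

lemma min_eval_form_Box_le:
  "v \<in> worlds M \<Longrightarrow> w \<in> worlds M \<Longrightarrow> min (eval_form M v (\<^bold>\<box> \<phi>)) (acc M v w) \<le> eval_form M w \<phi>"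
  using eval_form_Box_iff eval_form_bounds(2) by blast

lemma eval_form_Dia_iff:
  assumes v: "v \<in> worlds M"
  shows "eval_form M v (\<^bold>\<diamond> \<phi>) \<le> c \<longleftrightarrow> (\<forall>w\<in>worlds M. min (acc M v w) (eval_form M w \<phi>) \<le> c)"
proof -
  have "bdd_above ((\<lambda>w. min (acc M v w) (eval_form M w \<phi>)) ` worlds M)"
    by (rule bdd_aboveI2[where M = 1]) (simp add: min.coboundedI2 eval_form_bounds)
  moreover have "worlds M \<noteq> {}" using v by blast
  ultimately show ?thesis by (simp add: cSUP_le_iff)
qed

lemma min_le_eval_form_Dia:
  "v \<in> worlds M \<Longrightarrow> w \<in> worlds M \<Longrightarrow> min (acc M v w) (eval_form M w \<phi>) \<le> eval_form M v (\<^bold>\<diamond> \<phi>)"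
  using eval_form_Dia_iff by blast

lemma godel_axiom_sound:
  assumes "godel_axiom \<phi>" and v: "v \<in> worlds M"
  shows "eval_form M v \<phi> = 1"
  using assms(1)
proof cases
  case (1 \<phi> \<psi>) then show ?thesis using eval_form_in_unit[OF v, of \<phi>] by (auto simp: gimp_def)
next
  case (2 \<phi> \<psi> \<chi>) then show ?thesis
    using eval_form_in_unit[OF v, of \<phi>] eval_form_in_unit[OF v, of \<psi>] eval_form_in_unit[OF v, of \<chi>]
    by (auto simp: gimp_def)
next
  case (8 \<phi> \<chi> \<psi>) then show ?thesis
    using eval_form_in_unit[OF v, of \<phi>] eval_form_in_unit[OF v, of \<psi>] eval_form_in_unit[OF v, of \<chi>]
    by (auto simp: gimp_def)
next
  case (9 \<phi>) then show ?thesis using eval_form_in_unit[OF v, of \<phi>] by (auto simp: gimp_def)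
next
  case (5 \<phi> \<psi>) then show ?thesis
    using eval_form_in_unit[OF v, of \<phi>] eval_form_in_unit[OF v, of \<psi>]
    by (auto simp: gimp_def)
next
  case (10 \<phi> \<psi>) then show ?thesis
    using eval_form_in_unit[OF v, of \<phi>] eval_form_in_unit[OF v, of \<psi>]
    by (auto simp: gimp_def)
qed (auto simp: gimp_def)

lemma MG_theorem_sound: "MG_theorem \<phi> \<Longrightarrow> v \<in> worlds M \<Longrightarrow> eval_form M v \<phi> = 1"
proof (induction arbitrary: v rule: MG_theorem.induct)
  case (Godel \<phi>) then show ?case by (rule godel_axiom_sound)
next
  case (K_Box \<phi> \<psi>)
  let ?a = "eval_form M v (\<^bold>\<box> (\<phi> \<^bold>\<rightarrow> \<psi>))" and ?b = "eval_form M v (\<^bold>\<box> \<phi>)"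
  have u: "?a \<le> 1" "?b \<le> 1" by (rule eval_form_bounds[OF K_Box])+
  have "min ?a ?b \<le> eval_form M v (\<^bold>\<box> \<psi>)"
  proof (subst eval_form_Box_iff[OF K_Box], use u in simp, intro ballI)
    fix w assume w: "w \<in> worlds M"
    have "min ?a (acc M v w) \<le> eval_form M w \<phi> \<rightarrow>\<^sub>G eval_form M w \<psi>"
      using min_eval_form_Box_le[OF K_Box w, of "\<phi> \<^bold>\<rightarrow> \<psi>"] by (simp del: eval_form.simps(6))
    then have "min (min ?a (acc M v w)) (eval_form M w \<phi>) \<le> eval_form M w \<psi>"
      using le_gimp_iff u(1) by (metis min.coboundedI1)
    moreover have "min ?b (acc M v w) \<le> eval_form M w \<phi>"
      by (rule min_eval_form_Box_le[OF K_Box w])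
    ultimately show "min (min ?a ?b) (acc M v w) \<le> eval_form M w \<psi>" by linarith
  qed
  then have "?a \<le> ?b \<rightarrow>\<^sub>G eval_form M v (\<^bold>\<box> \<psi>)" using le_gimp_iff[OF u(1)] by simp
  then show ?case using gimp_eq_1_iff[OF u(1)] by simp
next
  case (Z_Box \<phi>)
  let ?b = "eval_form M v (\<^bold>\<box> \<phi>)"
  have u: "0 \<le> ?b" "?b \<le> 1" by (rule eval_form_bounds[OF Z_Box])+
  show ?case
  proof (cases "?b = 0")
    case True
    then show ?thesis using eval_form_in_unit[OF Z_Box, of "\<^bold>\<box> \<^bold>\<not> \<^bold>\<not> \<phi>"] by (simp add: gimp_def)
  next
    case False
    \<comment> \<open>Where \<open>acc M v w\<close> is positive, the positive value of \<box>
      \<phi> makes \<phi> positive at \<open>w\<close>, and the double negation of a positive value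
      is 1.\<close>
    have "1 \<le> eval_form M v (\<^bold>\<box> \<^bold>\<not> \<^bold>\<not> \<phi>)"
    proof (subst eval_form_Box_iff[OF Z_Box], simp, intro ballI)
      fix w assume w: "w \<in> worlds M"
      have "min ?b (acc M v w) \<le> eval_form M w \<phi>"
        by (rule min_eval_form_Box_le[OF Z_Box w])
      then show "min 1 (acc M v w) \<le> eval_form M w (\<^bold>\<not> \<^bold>\<not> \<phi>)"
        using False u eval_form_in_unit[OF w, of \<phi>] by (auto simp: gimp_def)
    qed
    then show ?thesis
      using eval_form_in_unit[OF Z_Box, of "\<^bold>\<box> \<^bold>\<not> \<^bold>\<not> \<phi>"] by (simp add: gimp_def)
  qed
next
  case (D_Dia \<phi> \<psi>)
  have "eval_form M v (\<^bold>\<diamond> (\<phi> \<^bold>\<or> \<psi>)) \<le> max (eval_form M v (\<^bold>\<diamond> \<phi>)) (eval_form M v (\<^bold>\<diamond> \<psi>))"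
    unfolding eval_form_Dia_iff[OF D_Dia]
  proof
    fix w assume "w \<in> worlds M"
    then have "min (acc M v w) (eval_form M w \<phi>) \<le> eval_form M v (\<^bold>\<diamond> \<phi>)"
      "min (acc M v w) (eval_form M w \<psi>) \<le> eval_form M v (\<^bold>\<diamond> \<psi>)"
      using eval_form_Dia_iff[OF D_Dia] by blast+
    then show "min (acc M v w) (eval_form M w (\<phi> \<^bold>\<or> \<psi>))
      \<le> max (eval_form M v (\<^bold>\<diamond> \<phi>)) (eval_form M v (\<^bold>\<diamond> \<psi>))"
      by (auto simp del: eval_form.simps(7))
  qed
  then show ?case by (simp add: gimp_def)
next
  case (Z_Dia \<phi>)
  let ?b = "eval_form M v (\<^bold>\<diamond> \<phi>)"
  show ?case
  proof (cases "?b = 0")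
    case True
    \<comment> \<open>A minimum that is at most 0 has a factor that is at most 0, and double
      negation keeps the value 0 of \<phi>.\<close>
    have "eval_form M v (\<^bold>\<diamond> \<^bold>\<not> \<^bold>\<not> \<phi>) \<le> 0"
      unfolding eval_form_Dia_iff[OF Z_Dia]
    proof
      fix w assume w: "w \<in> worlds M"
      then have "min (acc M v w) (eval_form M w \<phi>) \<le> 0"
        using eval_form_Dia_iff[OF Z_Dia] True by force
      then show "min (acc M v w) (eval_form M w (\<^bold>\<not> \<^bold>\<not> \<phi>)) \<le> 0"
        by (auto simp: gimp_def)
    qed
    then show ?thesis by (simp add: gimp_def)
  next
    case False
    then show ?thesis using eval_form_in_unit[OF Z_Dia, of "\<^bold>\<diamond> \<phi>"]
        eval_form_in_unit[OF Z_Dia, of "\<^bold>\<diamond> \<^bold>\<not> \<^bold>\<not> \<phi>"] by (simp add: gimp_def)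
  qed
next
  case F_Dia
  have "eval_form M v (\<^bold>\<diamond> \<^bold>\<bottom>) \<le> 0" using eval_form_Dia_iff[OF F_Dia, of "\<^bold>\<bottom>" 0] by auto
  then show ?case by (simp add: gimp_def)
next
  case (FS1 \<phi> \<psi>)
  let ?b = "eval_form M v (\<^bold>\<box> \<phi>)" and ?d = "eval_form M v (\<^bold>\<diamond> \<psi>)"
  have u: "?b \<le> 1" "?d \<le> 1" by (rule eval_form_bounds[OF FS1])+
  have "eval_form M v (\<^bold>\<diamond> (\<phi> \<^bold>\<rightarrow> \<psi>)) \<le> ?b \<rightarrow>\<^sub>G ?d"
    unfolding eval_form_Dia_iff[OF FS1]
  proof
    fix w assume w: "w \<in> worlds M"
    let ?c = "min (acc M v w) (eval_form M w \<phi> \<rightarrow>\<^sub>G eval_form M w \<psi>)"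
    have c: "?c \<le> 1" using M FS1 w by (intro min.coboundedI1) (auto simp: godel_kripke_def)
    have "?c \<le> eval_form M w \<phi> \<rightarrow>\<^sub>G eval_form M w \<psi>" by simp
    then have "min ?c (eval_form M w \<phi>) \<le> eval_form M w \<psi>" using le_gimp_iff[OF c] by blast
    moreover have "min ?b (acc M v w) \<le> eval_form M w \<phi>"
      by (rule min_eval_form_Box_le[OF FS1 w])
    moreover have "min (acc M v w) (eval_form M w \<psi>) \<le> ?d"
      using eval_form_Dia_iff[OF FS1] w by blast
    ultimately have "min ?c ?b \<le> ?d" by linarith
    then show "min (acc M v w) (eval_form M w (\<phi> \<^bold>\<rightarrow> \<psi>)) \<le> ?b \<rightarrow>\<^sub>G ?d"
      using le_gimp_iff[OF c] by (simp del: eval_form.simps(6,7))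
  qed
  then show ?case by (simp add: gimp_def)
next
  case (FS2 \<phi> \<psi>)
  let ?d = "eval_form M v (\<^bold>\<diamond> \<phi>)" and ?b = "eval_form M v (\<^bold>\<box> \<psi>)"
  let ?c = "?d \<rightarrow>\<^sub>G ?b"
  have u: "?b \<le> 1" by (rule eval_form_bounds[OF FS2])+
  have c: "?c \<le> 1" using u by (simp add: gimp_def)
  have "?c \<le> eval_form M v (\<^bold>\<box> (\<phi> \<^bold>\<rightarrow> \<psi>))"
    unfolding eval_form_Box_iff[OF FS2 c]
  proof
    fix w assume w: "w \<in> worlds M"
    have "min ?c ?d \<le> ?b" using le_gimp_iff[OF c] by blast
    moreover have "min (acc M v w) (eval_form M w \<phi>) \<le> ?d"
      using eval_form_Dia_iff[OF FS2] w by blast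
    moreover have "min ?b (acc M v w) \<le> eval_form M w \<psi>"
      by (rule min_eval_form_Box_le[OF FS2 w])
    ultimately have "min (min ?c (acc M v w)) (eval_form M w \<phi>) \<le> eval_form M w \<psi>" by linarith
    then show "min ?c (acc M v w) \<le> eval_form M w (\<phi> \<^bold>\<rightarrow> \<psi>)"
      using le_gimp_iff c by (metis eval_form.simps(5) min.coboundedI1)
  qed
  then show ?case by (simp add: gimp_def)
next
  case (MP \<phi> \<psi>)
  show ?case using MP.IH[OF MP.prems] eval_form_in_unit[OF MP.prems, of \<psi>]
    by (auto simp: gimp_def split: if_splits)
next
  case (Nec_Box \<phi>)
  have "1 \<le> eval_form M v (\<^bold>\<box> \<phi>)"
    unfolding eval_form_Box_iff[OF Nec_Box.prems order_refl] using Nec_Box.IH by auto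
  then show ?case using eval_form_in_unit[OF Nec_Box.prems, of "\<^bold>\<box> \<phi>"] by simp
next
  case (Mono_Dia \<phi> \<psi>)
  have "eval_form M v (\<^bold>\<diamond> \<phi>) \<le> eval_form M v (\<^bold>\<diamond> \<psi>)"
    unfolding eval_form_Dia_iff[OF Mono_Dia.prems]
  proof
    fix w assume w: "w \<in> worlds M"
    have "eval_form M w \<phi> \<le> eval_form M w \<psi>"
      using Mono_Dia.IH[OF w] eval_form_in_unit[OF w, of \<phi>] gimp_eq_1_iff by auto
    moreover have "min (acc M v w) (eval_form M w \<psi>) \<le> eval_form M v (\<^bold>\<diamond> \<psi>)"
      using eval_form_Dia_iff[OF Mono_Dia.prems] w by blast
    ultimately show "min (acc M v w) (eval_form M w \<phi>) \<le> eval_form M v (\<^bold>\<diamond> \<psi>)" by linarith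
  qed
  then show ?case by (simp add: gimp_def)
qed

lemma MG_derives_sound:
  assumes "MG_derives \<Gamma> \<phi>" and v: "v \<in> worlds M" and \<Gamma>: "\<forall>\<gamma>\<in>\<Gamma>. eval_form M v \<gamma> = 1"
  shows "eval_form M v \<phi> = 1"
  using assms(1)
proof induction
  case (Assm \<phi>) then show ?case using \<Gamma> by blast
next
  case (Thm \<phi>) then show ?case by (rule MG_theorem_sound[OF _ v])
next
  case (MP \<phi> \<psi>)
  then show ?case using eval_form_in_unit[OF v, of \<psi>] by (auto simp: gimp_def split: if_splits)
qed

end

section \<open>Theories and separating homomorphisms\<close>

text \<open>Closure under modus ponens only, not under the modal rules, matches local consequence.
  It also admits the sets of formulas whose box takes a value in a given up-set.\<close>

definition MG_theory :: "'v form set \<Rightarrow> bool" where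
  "MG_theory T \<longleftrightarrow> (\<forall>\<phi>. MG_theorem \<phi> \<longrightarrow> \<phi> \<in> T) \<and> (\<forall>\<phi> \<psi>. \<phi> \<^bold>\<rightarrow> \<psi> \<in> T \<longrightarrow> \<phi> \<in> T \<longrightarrow> \<psi> \<in> T)"

lemma MG_theory_Collect_derives: "MG_theory {\<phi>. MG_derives \<Gamma> \<phi>}"
  unfolding MG_theory_def using MG_derives.Thm MG_derives.MP by blast

context
  fixes T :: "'v form set"
  assumes T: "MG_theory T"
begin

lemma theory_theorem: "MG_theorem \<phi> \<Longrightarrow> \<phi> \<in> T"
  using T by (simp add: MG_theory_def)

lemma theory_axiom: "godel_axiom \<phi> \<Longrightarrow> \<phi> \<in> T"
  by (intro theory_theorem MG_theorem.Godel)

lemma theory_mp: "\<phi> \<^bold>\<rightarrow> \<psi> \<in> T \<Longrightarrow> \<phi> \<in> T \<Longrightarrow> \<psi> \<in> T"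
  using T unfolding MG_theory_def by blast

lemma theory_weaken: "\<psi> \<in> T \<Longrightarrow> \<phi> \<^bold>\<rightarrow> \<psi> \<in> T"
  using theory_mp[OF theory_axiom[OF godel_axiom.intros(1)]] .

lemma theory_S: "\<phi> \<^bold>\<rightarrow> \<psi> \<^bold>\<rightarrow> \<chi> \<in> T \<Longrightarrow> \<phi> \<^bold>\<rightarrow> \<psi> \<in> T \<Longrightarrow> \<phi> \<^bold>\<rightarrow> \<chi> \<in> T"
  using theory_mp[OF theory_mp[OF theory_axiom[OF godel_axiom.intros(2)]]] .

lemma theory_refl: "\<phi> \<^bold>\<rightarrow> \<phi> \<in> T"
  by (rule theory_S[of _ "\<phi> \<^bold>\<rightarrow> \<phi>"]) (rule theory_axiom, rule godel_axiom.intros)+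

lemma theory_trans: "\<phi> \<^bold>\<rightarrow> \<psi> \<in> T \<Longrightarrow> \<psi> \<^bold>\<rightarrow> \<chi> \<in> T \<Longrightarrow> \<phi> \<^bold>\<rightarrow> \<chi> \<in> T"
  by (rule theory_S[of _ \<psi>]) (rule theory_weaken)

lemma theory_conjI: "\<chi> \<^bold>\<rightarrow> \<phi> \<in> T \<Longrightarrow> \<chi> \<^bold>\<rightarrow> \<psi> \<in> T \<Longrightarrow> \<chi> \<^bold>\<rightarrow> \<phi> \<^bold>\<and> \<psi> \<in> T"
  using theory_S[OF theory_trans[OF _ theory_axiom[OF godel_axiom.intros(5)]]] .

lemma theory_disjE: "\<phi> \<^bold>\<rightarrow> \<chi> \<in> T \<Longrightarrow> \<psi> \<^bold>\<rightarrow> \<chi> \<in> T \<Longrightarrow> \<phi> \<^bold>\<or> \<psi> \<^bold>\<rightarrow> \<chi> \<in> T"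
  using theory_mp[OF theory_mp[OF theory_axiom[OF godel_axiom.intros(8)]]] .

text \<open>The deduction theorem holds because derivations from premises apply the modal rules to
  theorems only.\<close>

lemma theory_deduction:
  assumes "MG_derives (insert \<phi> T) \<psi>" shows "\<phi> \<^bold>\<rightarrow> \<psi> \<in> T"
  using assms
proof induction
  case (Assm \<psi>)
  then show ?case
  proof
    assume "\<psi> = \<phi>" then show ?thesis using theory_refl by simp
  qed (rule theory_weaken)
next
  case (Thm \<psi>) then show ?case by (intro theory_weaken theory_theorem)
next
  case (MP \<psi> \<chi>) show ?case by (rule theory_S[OF MP.IH])
qed

end

section \<open>Maximal theories and the homomorphisms they induce\<close>

text \<open>These are the worlds of every canonical model, named apart because they do not depend on
  \<open>\<Omega>\<close> and also interpret the nodes of the tree.\<close>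

definition MG_hom :: "('v form \<Rightarrow> real) \<Rightarrow> bool" where
  "MG_hom h \<longleftrightarrow> godel_hom h \<and> (\<forall>\<theta>. MG_theorem \<theta> \<longrightarrow> h \<theta> = 1)"

lemma worlds_canonical_model: "worlds (canonical_model \<Omega>) = Collect MG_hom"
  by (auto simp: canonical_model_def MG_hom_def)

text \<open>A theory maximal among those disjoint from \<open>D\<close> is linear by prelinearity:
  if neither implication belonged to it, each would imply a member of \<open>D\<close>, and the
  disjunction of these two members would be both in the theory and in \<open>D\<close>.\<close>

lemma maximal_theory_exists:
  assumes \<Gamma>: "MG_theory \<Gamma>" and disj: "\<And>\<delta> \<epsilon>. \<delta> \<in> D \<Longrightarrow> \<epsilon> \<in> D \<Longrightarrow> \<delta> \<^bold>\<or> \<epsilon> \<in> D"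
    and sep: "\<Gamma> \<inter> D = {}"
  obtains T where "MG_theory T" "\<Gamma> \<subseteq> T" "T \<inter> D = {}" "\<And>\<phi> \<psi>. \<phi> \<^bold>\<rightarrow> \<psi> \<in> T \<or> \<psi> \<^bold>\<rightarrow> \<phi> \<in> T"
proof -
  define \<A> :: "'a form set set" where "\<A> = {T. MG_theory T \<and> \<Gamma> \<subseteq> T \<and> T \<inter> D = {}}"
  have "\<exists>T\<in>\<A>. \<forall>X\<in>\<A>. T \<subseteq> X \<longrightarrow> X = T"
  proof (rule subset_Zorn_nonempty)
    show "\<A> \<noteq> {}" using \<Gamma> sep by (auto simp: \<A>_def)
    fix C assume C: "C \<noteq> {}" "subset.chain \<A> C"
    then have sub: "C \<subseteq> \<A>" and ch: "\<And>X Y. X \<in> C \<Longrightarrow> Y \<in> C \<Longrightarrow> X \<subseteq> Y \<or> Y \<subseteq> X"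
      by (auto simp: subset.chain_def)
    have "MG_theory (\<Union>C)"
      unfolding MG_theory_def
    proof (intro conjI allI impI)
      fix \<phi> :: "'a form" assume "MG_theorem \<phi>"
      then show "\<phi> \<in> \<Union>C" using C(1) sub theory_theorem unfolding \<A>_def by blast
    next
      fix \<phi> \<psi> assume "\<phi> \<^bold>\<rightarrow> \<psi> \<in> \<Union>C" "\<phi> \<in> \<Union>C"
      then obtain X Y where XY: "X \<in> C" "Y \<in> C" "\<phi> \<^bold>\<rightarrow> \<psi> \<in> X" "\<phi> \<in> Y" by blast
      then obtain Z where "Z \<in> C" "\<phi> \<^bold>\<rightarrow> \<psi> \<in> Z" "\<phi> \<in> Z" using ch[OF XY(1,2)] by blast
      then show "\<psi> \<in> \<Union>C" using sub theory_mp[of Z \<phi> \<psi>] unfolding \<A>_def by blast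
    qed
    then show "\<Union>C \<in> \<A>" using C(1) sub by (auto simp: \<A>_def)
  qed
  then obtain T where "T \<in> \<A>" and max\<A>: "\<forall>X\<in>\<A>. T \<subseteq> X \<longrightarrow> X = T" by blast
  then have T: "MG_theory T" "\<Gamma> \<subseteq> T" "T \<inter> D = {}" by (simp_all add: \<A>_def)
  have max: "X = T" if "MG_theory X" "T \<subseteq> X" "X \<inter> D = {}" for X
    using max\<A> that T(2) unfolding \<A>_def by blast
  have ext: "\<exists>\<delta>\<in>D. \<phi> \<^bold>\<rightarrow> \<delta> \<in> T" if "\<phi> \<notin> T" for \<phi>
  proof (rule ccontr)
    assume neg: "\<not> (\<exists>\<delta>\<in>D. \<phi> \<^bold>\<rightarrow> \<delta> \<in> T)"
    let ?X = "{\<psi>. MG_derives (insert \<phi> T) \<psi>}"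
    have "?X \<inter> D = {}" using neg theory_deduction[OF T(1)] by blast
    moreover have "insert \<phi> T \<subseteq> ?X" by (auto intro: MG_derives.Assm)
    ultimately show False using max[OF MG_theory_Collect_derives, of "insert \<phi> T"] that by blast
  qed
  have "\<phi> \<^bold>\<rightarrow> \<psi> \<in> T \<or> \<psi> \<^bold>\<rightarrow> \<phi> \<in> T" for \<phi> \<psi>
  proof (rule ccontr)
    assume "\<not> ?thesis"
    then obtain \<delta> \<epsilon> where d: "\<delta> \<in> D" "\<epsilon> \<in> D" "(\<phi> \<^bold>\<rightarrow> \<psi>) \<^bold>\<rightarrow> \<delta> \<in> T" "(\<psi> \<^bold>\<rightarrow> \<phi>) \<^bold>\<rightarrow> \<epsilon> \<in> T"
      using ext[of "\<phi> \<^bold>\<rightarrow> \<psi>"] ext[of "\<psi> \<^bold>\<rightarrow> \<phi>"] by blast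
    have "\<delta> \<^bold>\<or> \<epsilon> \<in> T"
    proof (rule theory_mp[OF T(1) theory_disjE[OF T(1)]])
      show "(\<phi> \<^bold>\<rightarrow> \<psi>) \<^bold>\<or> (\<psi> \<^bold>\<rightarrow> \<phi>) \<in> T" by (rule theory_axiom[OF T(1)]) (rule godel_axiom.intros)
      show "(\<phi> \<^bold>\<rightarrow> \<psi>) \<^bold>\<rightarrow> \<delta> \<^bold>\<or> \<epsilon> \<in> T"
        by (rule theory_trans[OF T(1) d(3) theory_axiom[OF T(1)]]) (rule godel_axiom.intros)
      show "(\<psi> \<^bold>\<rightarrow> \<phi>) \<^bold>\<rightarrow> \<delta> \<^bold>\<or> \<epsilon> \<in> T"
        by (rule theory_trans[OF T(1) d(4) theory_axiom[OF T(1)]]) (rule godel_axiom.intros)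
    qed
    then show False using disj[OF d(1,2)] T(3) by blast
  qed
  then show thesis using that T by blast
qed

instance form :: (countable) countable
  by countable_datatype

text \<open>Implication in a linear theory is a total preorder on the countable set of formulas, and
  embedding it in the unit interval gives the homomorphism. The construction controls which formulas
  get the value 1; the other values matter only through their order and are adjusted later.\<close>

lemma separating_hom_exists:
  fixes \<Gamma> :: "'v::countable form set"
  assumes "MG_theory \<Gamma>" and "\<And>\<delta> \<epsilon>. \<delta> \<in> D \<Longrightarrow> \<epsilon> \<in> D \<Longrightarrow> \<delta> \<^bold>\<or> \<epsilon> \<in> D"
    and "\<Gamma> \<inter> D = {}" and "D \<noteq> {}"
  obtains u where "MG_hom u" "\<And>\<phi>. \<phi> \<in> \<Gamma> \<Longrightarrow> u \<phi> = 1" "\<And>\<delta>. \<delta> \<in> D \<Longrightarrow> u \<delta> < 1"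
proof -
  obtain T where T: "MG_theory T" and T\<Gamma>: "\<Gamma> \<subseteq> T" and TD: "T \<inter> D = {}"
    and lin: "\<And>\<phi> \<psi>. \<phi> \<^bold>\<rightarrow> \<psi> \<in> T \<or> \<psi> \<^bold>\<rightarrow> \<phi> \<in> T"
    using maximal_theory_exists[OF assms(1-3)] by blast
  note [intro] = godel_axiom.intros
  note ax = theory_axiom[OF T]
  have top: "\<phi> \<^bold>\<rightarrow> \<^bold>\<not> \<^bold>\<bottom> \<in> T" for \<phi> using theory_weaken[OF T theory_refl[OF T]] .
  have top_iff: "\<^bold>\<not> \<^bold>\<bottom> \<^bold>\<rightarrow> \<phi> \<in> T \<longleftrightarrow> \<phi> \<in> T" for \<phi>
    using theory_mp[OF T _ theory_refl[OF T]] theory_weaken[OF T] by blast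
  have nontriv: "\<^bold>\<not> \<^bold>\<bottom> \<^bold>\<rightarrow> \<^bold>\<bottom> \<notin> T"
  proof
    assume "\<^bold>\<not> \<^bold>\<bottom> \<^bold>\<rightarrow> \<^bold>\<bottom> \<in> T"
    then have "\<phi> \<in> T" for \<phi> using theory_mp[OF T ax] top_iff by blast
    then show False using TD \<open>D \<noteq> {}\<close> by blast
  qed
  have tr: "x \<^bold>\<rightarrow> z \<in> T" if "x \<^bold>\<rightarrow> y \<in> T" "y \<^bold>\<rightarrow> z \<in> T" for x y z
    using theory_trans[OF T that] .
  have bt: "\<^bold>\<bottom> \<^bold>\<rightarrow> x \<in> T" for x using ax by blast
  show thesis
  proof (rule countable_preorder_embedding[of "\<lambda>x y. x \<^bold>\<rightarrow> y \<in> T" "\<^bold>\<bottom>" "\<^bold>\<not> \<^bold>\<bottom>", OF lin _ bt top nontriv])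
    show "x \<^bold>\<rightarrow> z \<in> T" if "x \<^bold>\<rightarrow> y \<in> T" "y \<^bold>\<rightarrow> z \<in> T" for x y z using tr[OF that] .
    fix u :: "'v form \<Rightarrow> real"
    assume u: "\<And>x. u x \<in> {0..1}" "u \<^bold>\<bottom> = 0" "u (\<^bold>\<not> \<^bold>\<bottom>) = 1" "\<And>x y. u x \<le> u y \<longleftrightarrow> x \<^bold>\<rightarrow> y \<in> T"
    have u1: "u \<phi> = 1 \<longleftrightarrow> \<phi> \<in> T" for \<phi>
      using u(1)[of \<phi>] u(3) u(4)[of "\<^bold>\<not> \<^bold>\<bottom>" \<phi>] top_iff[of \<phi>] by auto
    have conj: "u (\<phi> \<^bold>\<and> \<psi>) = min (u \<phi>) (u \<psi>)" for \<phi> \<psi>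
    proof -
      have "u (\<phi> \<^bold>\<and> \<psi>) \<le> u \<phi>" "u (\<phi> \<^bold>\<and> \<psi>) \<le> u \<psi>" using ax by (auto simp: u(4))
      moreover have "u \<phi> \<le> u (\<phi> \<^bold>\<and> \<psi>)" if "u \<phi> \<le> u \<psi>"
        using that theory_conjI[OF T theory_refl[OF T]] by (simp add: u(4))
      moreover have "u \<psi> \<le> u (\<phi> \<^bold>\<and> \<psi>)" if "u \<psi> \<le> u \<phi>"
        using that theory_conjI[OF T _ theory_refl[OF T]] by (simp add: u(4))
      ultimately show ?thesis by linarith
    qed
    have disj: "u (\<phi> \<^bold>\<or> \<psi>) = max (u \<phi>) (u \<psi>)" for \<phi> \<psi>
    proof -
      have "u \<phi> \<le> u (\<phi> \<^bold>\<or> \<psi>)" "u \<psi> \<le> u (\<phi> \<^bold>\<or> \<psi>)" using ax by (auto simp: u(4))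
      moreover have "u (\<phi> \<^bold>\<or> \<psi>) \<le> u \<psi>" if "u \<phi> \<le> u \<psi>"
        using that theory_disjE[OF T _ theory_refl[OF T]] by (simp add: u(4))
      moreover have "u (\<phi> \<^bold>\<or> \<psi>) \<le> u \<phi>" if "u \<psi> \<le> u \<phi>"
        using that theory_disjE[OF T theory_refl[OF T]] by (simp add: u(4))
      ultimately show ?thesis by linarith
    qed
    have imp: "u (\<phi> \<^bold>\<rightarrow> \<psi>) = u \<phi> \<rightarrow>\<^sub>G u \<psi>" for \<phi> \<psi>
    proof (cases "\<phi> \<^bold>\<rightarrow> \<psi> \<in> T")
      case True
      then show ?thesis using u1[of "\<phi> \<^bold>\<rightarrow> \<psi>"] u(4)[of \<phi> \<psi>] by (simp add: gimp_def)
    next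
      case False
      \<comment> \<open>A failing implication must be equivalent to its conclusion. It is not
        implied by its premise, since contraction would then derive it; so by linearity it implies
        its premise, and hence its conclusion.\<close>
      have "\<phi> \<^bold>\<rightarrow> \<phi> \<^bold>\<rightarrow> \<psi> \<notin> T" using False theory_S[OF T _ theory_refl[OF T]] by blast
      then have "(\<phi> \<^bold>\<rightarrow> \<psi>) \<^bold>\<rightarrow> \<phi> \<in> T" using lin by blast
      then have "(\<phi> \<^bold>\<rightarrow> \<psi>) \<^bold>\<rightarrow> \<psi> \<in> T" using theory_S[OF T theory_refl[OF T]] by blast
      moreover have "\<psi> \<^bold>\<rightarrow> \<phi> \<^bold>\<rightarrow> \<psi> \<in> T" using ax by blast
      ultimately have "u (\<phi> \<^bold>\<rightarrow> \<psi>) = u \<psi>" using u(4) by (meson antisym)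
      then show ?thesis using False u(4)[of \<phi> \<psi>] by (simp add: gimp_def)
    qed
    have "MG_hom u"
      using u(1,2) conj disj imp u1 theory_theorem[OF T] by (simp add: MG_hom_def godel_hom_def)
    moreover have "u \<delta> < 1" if "\<delta> \<in> D" for \<delta> using that TD u1[of \<delta>] u(1)[of \<delta>] by fastforce
    ultimately show thesis using that T\<Gamma> u1 by blast
  qed
qed

context
  fixes h :: "'v form \<Rightarrow> real"
  assumes h: "MG_hom h"
begin

lemma hom_bounds: "0 \<le> h \<phi>" "h \<phi> \<le> 1"
  using h by (auto simp: MG_hom_def godel_hom_def)

lemma hom_Fls: "h \<^bold>\<bottom> = 0" and hom_Disj: "h (\<phi> \<^bold>\<or> \<psi>) = max (h \<phi>) (h \<psi>)"
  and hom_Imp: "h (\<phi> \<^bold>\<rightarrow> \<psi>) = h \<phi> \<rightarrow>\<^sub>G h \<psi>"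
  using h by (auto simp: MG_hom_def godel_hom_def)

lemma hom_theorem: "MG_theorem \<theta> \<Longrightarrow> h \<theta> = 1"
  using h by (simp add: MG_hom_def)

lemma hom_imp_le: "h (\<phi> \<^bold>\<rightarrow> \<psi>) = 1 \<Longrightarrow> h \<phi> \<le> h \<psi>"
  using hom_bounds(2)[of \<phi>] by (auto simp: hom_Imp gimp_def split: if_splits)

lemma hom_theorem_le: "MG_theorem (\<phi> \<^bold>\<rightarrow> \<psi>) \<Longrightarrow> h \<phi> \<le> h \<psi>"
  using hom_theorem hom_imp_le by blast

lemma hom_Box_theorem: "MG_theorem \<theta> \<Longrightarrow> h (\<^bold>\<box> \<theta>) = 1"
  by (intro hom_theorem Nec_Box)

lemma hom_Box_mp: "min (h (\<^bold>\<box> (\<phi> \<^bold>\<rightarrow> \<psi>))) (h (\<^bold>\<box> \<phi>)) \<le> h (\<^bold>\<box> \<psi>)"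
  using hom_theorem_le[OF K_Box, of \<phi> \<psi>] le_gimp_iff[OF hom_bounds(2)] by (simp add: hom_Imp)

lemma hom_Dia_mono: "MG_theorem (\<phi> \<^bold>\<rightarrow> \<psi>) \<Longrightarrow> h (\<^bold>\<diamond> \<phi>) \<le> h (\<^bold>\<diamond> \<psi>)"
  by (intro hom_theorem_le Mono_Dia)

lemma hom_Dia_Disj_le: "h (\<^bold>\<diamond> (\<phi> \<^bold>\<or> \<psi>)) \<le> max (h (\<^bold>\<diamond> \<phi>)) (h (\<^bold>\<diamond> \<psi>))"
  using hom_theorem_le[OF D_Dia, of \<phi> \<psi>] by (simp add: hom_Disj)

lemma hom_Dia_Fls: "h (\<^bold>\<diamond> \<^bold>\<bottom>) = 0"
  using hom_theorem_le[OF F_Dia] hom_bounds by (metis antisym hom_Fls hom_imp_le hom_theorem F_Dia)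

lemma hom_FS1: "min (h (\<^bold>\<diamond> (\<phi> \<^bold>\<rightarrow> \<psi>))) (h (\<^bold>\<box> \<phi>)) \<le> h (\<^bold>\<diamond> \<psi>)"
  using hom_theorem_le[OF FS1, of \<phi> \<psi>] le_gimp_iff[OF hom_bounds(2)] by (simp add: hom_Imp)

lemma hom_FS2: "h (\<^bold>\<diamond> \<phi>) \<le> h (\<^bold>\<box> \<psi>) \<Longrightarrow> h (\<^bold>\<box> (\<phi> \<^bold>\<rightarrow> \<psi>)) = 1"
  using hom_theorem_le[OF FS2, of \<phi> \<psi>] hom_bounds(2)[of "\<^bold>\<box> (\<phi> \<^bold>\<rightarrow> \<psi>)"]
  by (simp add: hom_Imp gimp_def)

end

section \<open>Successors and the canonical model\<close>

text \<open>The Goedel operations depend only on the order and the endpoints of the unit interval,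
  so a strictly increasing map fixing 0 and 1 commutes with them, and theorems keep the value 1.
  Formulas with a modality in front act as generators and impose nothing further.\<close>

lemma MG_hom_rescale:
  assumes u: "MG_hom u" and g: "strict_mono_on {0..1} g" "g 0 = 0" "g 1 = 1"
  shows "MG_hom (\<lambda>\<phi>. g (u \<phi>))"
proof -
  have g_le: "g x \<le> g y \<longleftrightarrow> x \<le> y" if "x \<in> {0..1}" "y \<in> {0..1}" for x y :: real
    using strict_mono_on_leD[OF g(1)] strict_mono_onD[OF g(1)] that by (meson linorder_not_le)
  have ub: "u \<phi> \<in> {0..1}" for \<phi> using hom_bounds[OF u] by simp
  have g_u: "g (u \<phi>) \<le> g (u \<psi>) \<longleftrightarrow> u \<phi> \<le> u \<psi>" for \<phi> \<psi> using g_le[OF ub ub] .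
  have "g (u \<phi>) \<in> {0..1}" for \<phi> using g_le[of 0 "u \<phi>"] g_le[of "u \<phi>" 1] ub[of \<phi>] g by auto
  then show ?thesis
    using u g(2,3) g_u by (simp add: MG_hom_def godel_hom_def gimp_def min_def max_def)
qed

text \<open>The modal values of \<open>v\<close> in the up-set \<open>F\<close> are collapsed to 1, which is harmless for a
  successor whose degree of accessibility does not exceed any of them. The axioms FS1 and FS2 then
  force \<open>u\<close> to order the formulas compatibly with the remaining modal values.\<close>

lemma rescaled_successor:
  assumes v: "MG_hom v" and u: "MG_hom u" and \<Omega>: "finite \<Omega>"
    and up: "\<And>x y. x \<in> F \<Longrightarrow> x \<le> y \<Longrightarrow> y \<in> F" and one: "1 \<in> F"
    and box: "\<And>\<psi>. v (\<^bold>\<box> \<psi>) \<in> F \<Longrightarrow> u \<psi> = 1" and dia: "\<And>\<psi>. v (\<^bold>\<diamond> \<psi>) \<notin> F \<Longrightarrow> u \<psi> < 1"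
    and C: "finite C" "\<And>t c. (t, c) \<in> C \<Longrightarrow> t < 1 \<and> 0 < c \<and> (\<forall>x. x \<notin> F \<longrightarrow> x < c)"
  obtains w where "MG_hom w" "\<And>\<psi>. u \<psi> = 1 \<Longrightarrow> w \<psi> = 1"
    "\<And>\<psi>. \<psi> \<in> \<Omega> \<Longrightarrow> v (\<^bold>\<box> \<psi>) \<notin> F \<Longrightarrow> v (\<^bold>\<box> \<psi>) \<le> w \<psi>"
    "\<And>\<psi>. \<psi> \<in> \<Omega> \<Longrightarrow> v (\<^bold>\<diamond> \<psi>) \<notin> F \<Longrightarrow> w \<psi> \<le> v (\<^bold>\<diamond> \<psi>)"
    "\<And>\<psi> c. (u \<psi>, c) \<in> C \<Longrightarrow> w \<psi> \<le> c"
proof -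
  \<comment> \<open>FS2 gives \<box>(\<psi> \<rightarrow> \<chi>) the value 1, which lies in
    \<open>F\<close>, so \<open>u\<close> validates the implication.\<close>
  have fs2: "u \<psi> \<le> u \<chi>" if "v (\<^bold>\<diamond> \<psi>) \<le> v (\<^bold>\<box> \<chi>)" for \<psi> \<chi>
    using box[of "\<psi> \<^bold>\<rightarrow> \<chi>"] hom_FS2[OF v that] one hom_imp_le[OF u] by simp
  \<comment> \<open>By FS1 the value of \<diamond>(\<chi> \<rightarrow> \<psi>) cannot exceed that
    of \<diamond> \<psi>, so it stays outside \<open>F\<close> and \<open>u\<close> refutes \<chi>
    \<rightarrow> \<psi>.\<close>
  have fs1: "u \<psi> < u \<chi>" if "v (\<^bold>\<diamond> \<psi>) < v (\<^bold>\<box> \<chi>)" "v (\<^bold>\<diamond> \<psi>) \<notin> F" for \<psi> \<chi>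
  proof -
    have "v (\<^bold>\<diamond> (\<chi> \<^bold>\<rightarrow> \<psi>)) \<le> v (\<^bold>\<diamond> \<psi>)" using hom_FS1[OF v, of \<chi> \<psi>] that(1) by linarith
    then have "u (\<chi> \<^bold>\<rightarrow> \<psi>) < 1" using dia up that(2) by blast
    then show ?thesis by (auto simp: hom_Imp[OF u] gimp_def split: if_splits)
  qed
  \<comment> \<open>\<open>P\<close> holds lower and \<open>Q\<close> upper bounds for the rescaling
    at values of \<open>u\<close>. The pairs at 0 and 1 pin the endpoints, and \<open>C\<close> adds
    further upper bounds, with which the box successor keeps its target formula low.\<close>
  define P where "P = {(0, 0), (1, 1)} \<union> (\<lambda>\<psi>. (u \<psi>, v (\<^bold>\<box> \<psi>))) ` {\<psi> \<in> \<Omega>. v (\<^bold>\<box> \<psi>) \<notin> F}"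
  define Q where "Q = {(0, 0), (1, 1)} \<union> (\<lambda>\<psi>. (u \<psi>, v (\<^bold>\<diamond> \<psi>))) ` {\<psi> \<in> \<Omega>. v (\<^bold>\<diamond> \<psi>) \<notin> F} \<union> C"
  have fin: "finite P" "finite Q" using \<Omega> C(1) by (auto simp: P_def Q_def)
  have PE: thesis if "(s, l) \<in> P" "s = 0 \<Longrightarrow> l = 0 \<Longrightarrow> thesis" "s = 1 \<Longrightarrow> l = 1 \<Longrightarrow> thesis"
    "\<And>\<psi>. s = u \<psi> \<Longrightarrow> l = v (\<^bold>\<box> \<psi>) \<Longrightarrow> v (\<^bold>\<box> \<psi>) \<notin> F \<Longrightarrow> thesis" for s l thesis
    using that by (auto simp: P_def)
  have QE: thesis if "(t, c) \<in> Q" "t = 0 \<Longrightarrow> c = 0 \<Longrightarrow> thesis" "t = 1 \<Longrightarrow> c = 1 \<Longrightarrow> thesis"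
    "\<And>\<psi>. t = u \<psi> \<Longrightarrow> c = v (\<^bold>\<diamond> \<psi>) \<Longrightarrow> v (\<^bold>\<diamond> \<psi>) \<notin> F \<Longrightarrow> thesis" "(t, c) \<in> C \<Longrightarrow> thesis" for t c thesis
    using that by (auto simp: Q_def)
  have box_lt: "v (\<^bold>\<box> \<psi>) < 1" if "v (\<^bold>\<box> \<psi>) \<notin> F" for \<psi>
    using up[OF one, of "v (\<^bold>\<box> \<psi>)"] that by linarith
  \<comment> \<open>Comparison with the endpoint 0 is obtained by taking \<bottom> for the other
    formula, in \<open>fs1\<close> here and in \<open>fs2\<close> below.\<close>
  have box_pos: "0 < u \<psi>" if "v (\<^bold>\<box> \<psi>) \<notin> F" "0 < v (\<^bold>\<box> \<psi>)" for \<psi>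
  proof -
    have "0 \<notin> F" using up[of 0 "v (\<^bold>\<box> \<psi>)"] that by auto
    then show ?thesis using fs1[of "\<^bold>\<bottom>" \<psi>] that hom_Dia_Fls[OF v] hom_Fls[OF u] by simp
  qed
  have dia_zero: "u \<psi> \<le> 0" if "v (\<^bold>\<diamond> \<psi>) \<le> 0" for \<psi>
    using fs2[of \<psi> "\<^bold>\<bottom>"] that hom_bounds(1)[OF v, of "\<^bold>\<box> \<^bold>\<bottom>"] hom_Fls[OF u] by simp
  note vb = hom_bounds[OF v] and ub = hom_bounds[OF u]
  \<comment> \<open>Two formulas compare by \<open>fs1\<close>. A bound from \<open>C\<close>
    exceeds every value outside \<open>F\<close>, so no box value among the constraints can lie
    above it.\<close>
  have sep: "t < s" if p: "(s, l) \<in> P" and q: "(t, c) \<in> Q" and "c < l" for s l t c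
  proof (rule PE[OF p]; rule QE[OF q])
    fix \<psi> \<chi> assume "s = u \<psi>" "l = v (\<^bold>\<box> \<psi>)" "t = u \<chi>" "c = v (\<^bold>\<diamond> \<chi>)" "v (\<^bold>\<diamond> \<chi>) \<notin> F"
    then show ?thesis using fs1 \<open>c < l\<close> by simp
  next
    fix \<psi> assume "s = u \<psi>" "l = v (\<^bold>\<box> \<psi>)" "v (\<^bold>\<box> \<psi>) \<notin> F" "t = 0" "c = 0"
    then show ?thesis using box_pos \<open>c < l\<close> by simp
  next
    fix \<psi> assume "s = u \<psi>" "l = v (\<^bold>\<box> \<psi>)" "v (\<^bold>\<box> \<psi>) \<notin> F" "t = 1" "c = 1"
    then show ?thesis using box_lt[of \<psi>] \<open>c < l\<close> by simp
  next
    fix \<psi> assume "s = u \<psi>" "l = v (\<^bold>\<box> \<psi>)" "v (\<^bold>\<box> \<psi>) \<notin> F" "(t, c) \<in> C"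
    then show ?thesis using C(2)[of t c] \<open>c < l\<close> by force
  next
    fix \<psi> assume "s = 0" "l = 0" "t = u \<psi>" "c = v (\<^bold>\<diamond> \<psi>)"
    then show ?thesis using vb(1)[of "\<^bold>\<diamond> \<psi>"] \<open>c < l\<close> by simp
  next
    fix \<psi> assume "s = 1" "l = 1" "t = u \<psi>" "c = v (\<^bold>\<diamond> \<psi>)" "v (\<^bold>\<diamond> \<psi>) \<notin> F"
    then show ?thesis using dia by simp
  qed (use \<open>c < l\<close> C(2)[of t c] in force)+
  have sep': "t \<le> s" if p: "(s, l) \<in> P" and q: "(t, c) \<in> Q" and "c \<le> l" for s l t c
  proof (rule PE[OF p]; rule QE[OF q])
    fix \<psi> \<chi> assume "s = u \<psi>" "l = v (\<^bold>\<box> \<psi>)" "t = u \<chi>" "c = v (\<^bold>\<diamond> \<chi>)"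
    then show ?thesis using fs2 \<open>c \<le> l\<close> by simp
  next
    fix \<psi> assume "s = u \<psi>" "l = v (\<^bold>\<box> \<psi>)" "v (\<^bold>\<box> \<psi>) \<notin> F" "t = 0" "c = 0"
    then show ?thesis using ub by simp
  next
    fix \<psi> assume "s = u \<psi>" "l = v (\<^bold>\<box> \<psi>)" "v (\<^bold>\<box> \<psi>) \<notin> F" "t = 1" "c = 1"
    then show ?thesis using box_lt[of \<psi>] \<open>c \<le> l\<close> by simp
  next
    fix \<psi> assume "s = u \<psi>" "l = v (\<^bold>\<box> \<psi>)" "v (\<^bold>\<box> \<psi>) \<notin> F" "(t, c) \<in> C"
    then show ?thesis using C(2)[of t c] \<open>c \<le> l\<close> by force
  next
    fix \<psi> assume "s = 0" "l = 0" "t = u \<psi>" "c = v (\<^bold>\<diamond> \<psi>)"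
    then show ?thesis using dia_zero \<open>c \<le> l\<close> by simp
  next
    fix \<psi> assume "s = 1" "l = 1" "t = u \<psi>" "c = v (\<^bold>\<diamond> \<psi>)"
    then show ?thesis using ub by simp
  qed (use \<open>c \<le> l\<close> C(2)[of t c] in force)+
  have P01: "(0, 0) \<in> P" "(1, 1) \<in> P" and Q01: "(0, 0) \<in> Q" "(1, 1) \<in> Q"
    by (simp_all add: P_def Q_def)
  show thesis
  proof (rule strict_mono_interpolation[OF fin P01 Q01])
    fix g assume g: "strict_mono_on {0..1} g" "g 0 = 0" "g 1 = (1::real)"
      "\<And>s l. s \<in> {0..1} \<Longrightarrow> (s, l) \<in> P \<Longrightarrow> l \<le> g s" "\<And>t c. t \<in> {0..1} \<Longrightarrow> (t, c) \<in> Q \<Longrightarrow> g t \<le> c"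
    have unit: "u \<psi> \<in> {0..1}" for \<psi> using ub by simp
    show thesis
    proof (rule that[OF MG_hom_rescale[OF u g(1-3)]])
      show "g (u \<psi>) = 1" if "u \<psi> = 1" for \<psi> using that g(3) by simp
      show "v (\<^bold>\<box> \<psi>) \<le> g (u \<psi>)" if "\<psi> \<in> \<Omega>" "v (\<^bold>\<box> \<psi>) \<notin> F" for \<psi>
        using that by (intro g(4)[OF unit]) (auto simp: P_def)
      show "g (u \<psi>) \<le> v (\<^bold>\<diamond> \<psi>)" if "\<psi> \<in> \<Omega>" "v (\<^bold>\<diamond> \<psi>) \<notin> F" for \<psi>
        using that by (intro g(5)[OF unit]) (auto simp: Q_def)
      show "g (u \<psi>) \<le> c" if "(u \<psi>, c) \<in> C" for \<psi> c
        using that by (intro g(5)[OF unit]) (auto simp: Q_def)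
    qed
  qed (use sep sep' in blast)+
qed

section \<open>Construction of diamond and box successors\<close>

lemma MG_theory_theorems: "MG_theory {\<theta>. MG_theorem \<theta>}"
  unfolding MG_theory_def using MG_theorem.MP by blast

text \<open>A variant of FS1 with the implication under the box, obtained from the theorem \<phi>
  \<rightarrow> ((\<phi> \<rightarrow> \<psi>) \<rightarrow> \<psi>) by monotonicity of the diamond
  and FS1. It separates the theory from \<open>D\<close> in the construction of diamond
  successors.\<close>

lemma hom_Box_Dia:
  assumes h: "MG_hom h"
  shows "min (h (\<^bold>\<box> (\<phi> \<^bold>\<rightarrow> \<psi>))) (h (\<^bold>\<diamond> \<phi>)) \<le> h (\<^bold>\<diamond> \<psi>)"
proof -
  note t = MG_theory_theorems
  have "(\<phi> \<^bold>\<rightarrow> ((\<phi> \<^bold>\<rightarrow> \<psi>) \<^bold>\<rightarrow> \<psi>)) \<in> {\<theta>. MG_theorem \<theta>}"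
    by (rule theory_trans[OF t theory_axiom[OF t godel_axiom.intros(1)]
          theory_mp[OF t theory_axiom[OF t godel_axiom.intros(2)] theory_refl[OF t]]])
  then have "h (\<^bold>\<diamond> \<phi>) \<le> h (\<^bold>\<diamond> ((\<phi> \<^bold>\<rightarrow> \<psi>) \<^bold>\<rightarrow> \<psi>))" using hom_Dia_mono[OF h] by simp
  then show ?thesis using hom_FS1[OF h, of "\<phi> \<^bold>\<rightarrow> \<psi>" \<psi>] by linarith
qed

text \<open>The up-set is left general because diamond successors use a closed ray
  \<open>{\<alpha>..}\<close> and box successors an open one \<open>{\<alpha><..}\<close>.\<close>

lemma MG_theory_Box:
  assumes h: "MG_hom h" and up: "\<And>x y. x \<in> F \<Longrightarrow> x \<le> y \<Longrightarrow> y \<in> F" and one: "1 \<in> F"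
  shows "MG_theory {\<phi>. h (\<^bold>\<box> \<phi>) \<in> F}"
  unfolding MG_theory_def
proof (intro conjI allI impI; unfold mem_Collect_eq)
  fix \<phi> \<psi> assume "h (\<^bold>\<box> (\<phi> \<^bold>\<rightarrow> \<psi>)) \<in> F" "h (\<^bold>\<box> \<phi>) \<in> F"
  then have "min (h (\<^bold>\<box> (\<phi> \<^bold>\<rightarrow> \<psi>))) (h (\<^bold>\<box> \<phi>)) \<in> F" by (simp add: min_def)
  then show "h (\<^bold>\<box> \<psi>) \<in> F" using up hom_Box_mp[OF h] by blast
qed (simp add: hom_Box_theorem[OF h] one)

text \<open>The degree of access is \<alpha>, the value of \<diamond> \<phi>, so values from
  \<alpha> upward need not be told apart. The theory consists of what \<phi> implies under boxes of
  value at least \<alpha>, so that \<phi> itself gets the value 1; \<open>D\<close> consists of the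
  formulas whose diamond stays below \<alpha>.\<close>

lemma dia_successor:
  fixes v :: "'v::countable form \<Rightarrow> real"
  assumes v: "MG_hom v" and \<Omega>: "finite \<Omega>"
  obtains w where "MG_hom w" "v (\<^bold>\<diamond> \<phi>) \<le> w \<phi>"
    "\<And>\<psi>. \<psi> \<in> \<Omega> \<Longrightarrow> min (v (\<^bold>\<diamond> \<phi>)) (v (\<^bold>\<box> \<psi>)) \<le> w \<psi> \<and> min (v (\<^bold>\<diamond> \<phi>)) (w \<psi>) \<le> v (\<^bold>\<diamond> \<psi>)"
proof (cases "v (\<^bold>\<diamond> \<phi>) = 0")
  case True
  \<comment> \<open>With degree 0 all conditions are trivial, so \<open>v\<close> serves as its own
    successor. The construction below needs a positive degree to have \<bottom> in
    \<open>D\<close>.\<close>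
  show thesis by (rule that[OF v]) (use True hom_bounds[OF v] in \<open>auto simp: min_def\<close>)
next
  case False
  let ?\<alpha> = "v (\<^bold>\<diamond> \<phi>)"
  let ?T = "{\<beta>. v (\<^bold>\<box> \<beta>) \<in> {?\<alpha>..}}"
  have \<alpha>: "0 < ?\<alpha>" "?\<alpha> \<le> 1" using False hom_bounds[OF v, of "\<^bold>\<diamond> \<phi>"] by auto
  have T: "MG_theory ?T" using \<alpha> by (intro MG_theory_Box[OF v]) auto
  define \<Gamma> where "\<Gamma> = {\<beta>. \<phi> \<^bold>\<rightarrow> \<beta> \<in> ?T}"
  define D where "D = {\<delta>. v (\<^bold>\<diamond> \<delta>) < ?\<alpha>}"
  have \<Gamma>: "MG_theory \<Gamma>" unfolding MG_theory_def
  proof (intro conjI allI impI)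
    show "\<beta> \<in> \<Gamma>" if "MG_theorem \<beta>" for \<beta>
      unfolding \<Gamma>_def mem_Collect_eq[of _ "\<lambda>\<beta>. \<phi> \<^bold>\<rightarrow> \<beta> \<in> ?T"]
      by (intro theory_weaken[OF T] theory_theorem[OF T] that)
    show "\<chi> \<in> \<Gamma>" if "\<beta> \<^bold>\<rightarrow> \<chi> \<in> \<Gamma>" "\<beta> \<in> \<Gamma>" for \<beta> \<chi>
      using theory_S[OF T] that unfolding \<Gamma>_def mem_Collect_eq[of _ "\<lambda>\<beta>. \<phi> \<^bold>\<rightarrow> \<beta> \<in> ?T"] .
  qed
  have disj: "\<delta> \<^bold>\<or> \<epsilon> \<in> D" if "\<delta> \<in> D" "\<epsilon> \<in> D" for \<delta> \<epsilon>
    using that hom_Dia_Disj_le[OF v, of \<delta> \<epsilon>] by (auto simp: D_def)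
  have sep: "\<Gamma> \<inter> D = {}"
  proof (rule ccontr)
    assume "\<Gamma> \<inter> D \<noteq> {}"
    then obtain \<delta> where "v (\<^bold>\<box> (\<phi> \<^bold>\<rightarrow> \<delta>)) \<ge> ?\<alpha>" "v (\<^bold>\<diamond> \<delta>) < ?\<alpha>" by (auto simp: \<Gamma>_def D_def)
    then show False using hom_Box_Dia[OF v, of \<phi> \<delta>] by linarith
  qed
  have "\<^bold>\<bottom> \<in> D" using \<alpha> hom_Dia_Fls[OF v] by (simp add: D_def)
  then obtain u where u: "MG_hom u" "\<And>\<beta>. \<beta> \<in> \<Gamma> \<Longrightarrow> u \<beta> = 1" "\<And>\<delta>. \<delta> \<in> D \<Longrightarrow> u \<delta> < 1"
    using separating_hom_exists[OF \<Gamma> disj sep] by blast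
  have box: "u \<psi> = 1" if "v (\<^bold>\<box> \<psi>) \<in> {?\<alpha>..}" for \<psi>
    using u(2)[of \<psi>] theory_weaken[OF T, of \<psi> \<phi>] that by (simp add: \<Gamma>_def)
  have u\<phi>: "u \<phi> = 1" using u(2)[of \<phi>] theory_refl[OF T, of \<phi>] by (simp add: \<Gamma>_def)
  show thesis
  proof (rule rescaled_successor[OF v u(1) \<Omega>, where F = "{?\<alpha>..}" and C = "{}"])
    show "y \<in> {?\<alpha>..}" if "x \<in> {?\<alpha>..}" "x \<le> y" for x y using that by simp
    show "1 \<in> {?\<alpha>..}" using \<alpha> by simp
    show "u \<psi> = 1" if "v (\<^bold>\<box> \<psi>) \<in> {?\<alpha>..}" for \<psi> by (rule box[OF that])
    show "u \<psi> < 1" if "v (\<^bold>\<diamond> \<psi>) \<notin> {?\<alpha>..}" for \<psi> using that by (intro u(3)) (simp add: D_def)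
    fix w assume w: "MG_hom w" "\<And>\<psi>. u \<psi> = 1 \<Longrightarrow> w \<psi> = 1"
      "\<And>\<psi>. \<psi> \<in> \<Omega> \<Longrightarrow> v (\<^bold>\<box> \<psi>) \<notin> {?\<alpha>..} \<Longrightarrow> v (\<^bold>\<box> \<psi>) \<le> w \<psi>"
      "\<And>\<psi>. \<psi> \<in> \<Omega> \<Longrightarrow> v (\<^bold>\<diamond> \<psi>) \<notin> {?\<alpha>..} \<Longrightarrow> w \<psi> \<le> v (\<^bold>\<diamond> \<psi>)"
    show thesis
    proof (rule that[OF w(1)])
      show "?\<alpha> \<le> w \<phi>" using w(2)[OF u\<phi>] \<alpha> by simp
      fix \<psi> assume \<psi>: "\<psi> \<in> \<Omega>"
      have "min ?\<alpha> (v (\<^bold>\<box> \<psi>)) \<le> w \<psi>"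
        using w(2)[OF box, of \<psi>] w(3)[OF \<psi>] \<alpha> by (cases "?\<alpha> \<le> v (\<^bold>\<box> \<psi>)") auto
      moreover have "min ?\<alpha> (w \<psi>) \<le> v (\<^bold>\<diamond> \<psi>)"
        using w(4)[OF \<psi>] by (cases "?\<alpha> \<le> v (\<^bold>\<diamond> \<psi>)") auto
      ultimately show "min ?\<alpha> (v (\<^bold>\<box> \<psi>)) \<le> w \<psi> \<and> min ?\<alpha> (w \<psi>) \<le> v (\<^bold>\<diamond> \<psi>)" by blast
    qed
  qed simp_all
qed

text \<open>The infimum defining \<box> \<phi> need not be attained, so the successor only has to
  bring it below a given \<beta>. Modal values strictly above that of \<box> \<phi> are collapsed to
  1, and \<phi> is kept below a degree \<gamma> that exceeds the value of \<box> \<phi> but not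
  \<beta>.\<close>

lemma box_successor:
  fixes v :: "'v::countable form \<Rightarrow> real"
  assumes v: "MG_hom v" and \<Omega>: "finite \<Omega>" and \<beta>: "v (\<^bold>\<box> \<phi>) < \<beta>" "\<beta> \<le> 1"
  obtains w \<gamma> where "MG_hom w" "0 \<le> \<gamma>" "\<gamma> \<le> \<beta>" "w \<phi> < \<gamma>"
    "\<And>\<psi>. \<psi> \<in> \<Omega> \<Longrightarrow> min \<gamma> (v (\<^bold>\<box> \<psi>)) \<le> w \<psi> \<and> min \<gamma> (w \<psi>) \<le> v (\<^bold>\<diamond> \<psi>)"
proof -
  let ?\<alpha> = "v (\<^bold>\<box> \<phi>)"
  define \<Gamma> where "\<Gamma> = {\<beta>. v (\<^bold>\<box> \<beta>) \<in> {?\<alpha><..}}"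
  have \<alpha>: "0 \<le> ?\<alpha>" "?\<alpha> < 1" using \<beta> hom_bounds[OF v, of "\<^bold>\<box> \<phi>"] by auto
  have \<Gamma>: "MG_theory \<Gamma>" unfolding \<Gamma>_def using \<alpha> by (intro MG_theory_Box[OF v]) auto
  \<comment> \<open>The formulas that imply \<phi> over the theory are closed under disjunction and
    include \<phi>. FS2 will place among them every \<psi> whose diamond is at most \<box>
    \<phi>.\<close>
  define D where "D = {\<delta>. \<delta> \<^bold>\<rightarrow> \<phi> \<in> \<Gamma>}"
  have disj: "\<delta> \<^bold>\<or> \<epsilon> \<in> D" if "\<delta> \<in> D" "\<epsilon> \<in> D" for \<delta> \<epsilon>
    using that theory_disjE[OF \<Gamma>] by (simp add: D_def)
  have "\<phi> \<notin> \<Gamma>" by (simp add: \<Gamma>_def)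
  then have sep: "\<Gamma> \<inter> D = {}" using theory_mp[OF \<Gamma>] by (auto simp: D_def)
  have \<phi>D: "\<phi> \<in> D" using theory_refl[OF \<Gamma>] by (simp add: D_def)
  obtain u where u: "MG_hom u" "\<And>\<beta>. \<beta> \<in> \<Gamma> \<Longrightarrow> u \<beta> = 1" "\<And>\<delta>. \<delta> \<in> D \<Longrightarrow> u \<delta> < 1"
    using separating_hom_exists[OF \<Gamma> disj sep] \<phi>D by blast
  have box: "u \<psi> = 1" if "v (\<^bold>\<box> \<psi>) \<in> {?\<alpha><..}" for \<psi>
    using u(2)[of \<psi>] that by (simp add: \<Gamma>_def)
  have dia: "u \<psi> < 1" if "v (\<^bold>\<diamond> \<psi>) \<notin> {?\<alpha><..}" for \<psi>
  proof (rule u(3))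
    have "v (\<^bold>\<box> (\<psi> \<^bold>\<rightarrow> \<phi>)) = 1" using that by (intro hom_FS2[OF v]) simp
    then show "\<psi> \<in> D" using \<alpha> by (simp add: D_def \<Gamma>_def)
  qed
  \<comment> \<open>Keeping the degree at or below every diamond value above \<alpha> makes
    \<open>min \<gamma> (w \<psi>)\<close> respect those values whatever \<open>w \<psi>\<close> is.
    Finiteness of \<open>\<Omega>\<close> keeps \<gamma> strictly above \<alpha>.\<close>
  define \<gamma> where "\<gamma> = Min (insert \<beta> {x \<in> (\<lambda>\<psi>. v (\<^bold>\<diamond> \<psi>)) ` \<Omega>. ?\<alpha> < x})"
  have \<gamma>_le: "\<gamma> \<le> \<beta>" "\<And>\<psi>. \<psi> \<in> \<Omega> \<Longrightarrow> ?\<alpha> < v (\<^bold>\<diamond> \<psi>) \<Longrightarrow> \<gamma> \<le> v (\<^bold>\<diamond> \<psi>)"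
    unfolding \<gamma>_def using \<Omega> by (auto intro!: Min_le)
  have \<gamma>: "?\<alpha> < \<gamma>" unfolding \<gamma>_def using \<Omega> \<beta> by (subst Min_gr_iff) auto
  define c where "c = (?\<alpha> + \<gamma>) / 2"
  have c: "?\<alpha> < c" "c < \<gamma>" using \<gamma> by (auto simp: c_def)
  show thesis
  proof (rule rescaled_successor[OF v u(1) \<Omega>, where F = "{?\<alpha><..}" and C = "{(u \<phi>, c)}"])
    show "y \<in> {?\<alpha><..}" if "x \<in> {?\<alpha><..}" "x \<le> y" for x y using that by simp
    show "1 \<in> {?\<alpha><..}" using \<alpha> by simp
    show "u \<psi> = 1" if "v (\<^bold>\<box> \<psi>) \<in> {?\<alpha><..}" for \<psi> by (rule box[OF that])
    show "u \<psi> < 1" if "v (\<^bold>\<diamond> \<psi>) \<notin> {?\<alpha><..}" for \<psi> by (rule dia[OF that])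
    show "t < 1 \<and> 0 < d \<and> (\<forall>x. x \<notin> {?\<alpha><..} \<longrightarrow> x < d)" if "(t, d) \<in> {(u \<phi>, c)}" for t d
      using that u(3)[OF \<phi>D] c \<alpha> by auto
    fix w assume w: "MG_hom w" "\<And>\<psi>. u \<psi> = 1 \<Longrightarrow> w \<psi> = 1"
      "\<And>\<psi>. \<psi> \<in> \<Omega> \<Longrightarrow> v (\<^bold>\<box> \<psi>) \<notin> {?\<alpha><..} \<Longrightarrow> v (\<^bold>\<box> \<psi>) \<le> w \<psi>"
      "\<And>\<psi>. \<psi> \<in> \<Omega> \<Longrightarrow> v (\<^bold>\<diamond> \<psi>) \<notin> {?\<alpha><..} \<Longrightarrow> w \<psi> \<le> v (\<^bold>\<diamond> \<psi>)"
      "\<And>\<psi> d. (u \<psi>, d) \<in> {(u \<phi>, c)} \<Longrightarrow> w \<psi> \<le> d"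
    show thesis
    proof (rule that[OF w(1) _ \<gamma>_le(1)])
      show "0 \<le> \<gamma>" using \<alpha> \<gamma> by linarith
      show "w \<phi> < \<gamma>" using w(5)[of \<phi> c] c by simp
      fix \<psi> assume \<psi>: "\<psi> \<in> \<Omega>"
      have "min \<gamma> (v (\<^bold>\<box> \<psi>)) \<le> w \<psi>"
        using w(2)[OF box, of \<psi>] w(3)[OF \<psi>] \<gamma>_le(1) \<beta> by (cases "?\<alpha> < v (\<^bold>\<box> \<psi>)") auto
      moreover have "min \<gamma> (w \<psi>) \<le> v (\<^bold>\<diamond> \<psi>)"
        using w(4)[OF \<psi>] \<gamma>_le(2)[OF \<psi>] by (cases "?\<alpha> < v (\<^bold>\<diamond> \<psi>)") auto
      ultimately show "min \<gamma> (v (\<^bold>\<box> \<psi>)) \<le> w \<psi> \<and> min \<gamma> (w \<psi>) \<le> v (\<^bold>\<diamond> \<psi>)" by blast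
    qed
  qed simp
qed

section \<open>Truth lemma and diamond witnesses in the canonical model\<close>

text \<open>By residuation, a lower bound for the canonical degree is given by inequalities of the
  kind that the successor lemmas provide, so their degrees never exceed the canonical one.\<close>

lemma le_canonical_acc_iff:
  assumes \<Omega>: "finite \<Omega>" and r: "r \<le> 1"
  shows "r \<le> canonical_acc \<Omega> h g \<longleftrightarrow>
    (\<forall>\<phi>\<in>\<Omega>. (\<^bold>\<box> \<phi> \<in> \<Omega> \<longrightarrow> min r (h (\<^bold>\<box> \<phi>)) \<le> g \<phi>) \<and> (\<^bold>\<diamond> \<phi> \<in> \<Omega> \<longrightarrow> min r (g \<phi>) \<le> h (\<^bold>\<diamond> \<phi>)))"
proof -
  let ?S = "insert 1 ({h (\<^bold>\<box> \<phi>) \<rightarrow>\<^sub>G g \<phi> | \<phi>. \<phi> \<in> \<Omega> \<and> \<^bold>\<box> \<phi> \<in> \<Omega>} \<union>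
    {g \<phi> \<rightarrow>\<^sub>G h (\<^bold>\<diamond> \<phi>) | \<phi>. \<phi> \<in> \<Omega> \<and> \<^bold>\<diamond> \<phi> \<in> \<Omega>})"
  have "finite ?S" using \<Omega> by simp
  then have "r \<le> Inf ?S \<longleftrightarrow> (\<forall>x\<in>?S. r \<le> x)" by (intro le_cInf_iff) auto
  also have "\<dots> \<longleftrightarrow> (\<forall>\<phi>\<in>\<Omega>. (\<^bold>\<box> \<phi> \<in> \<Omega> \<longrightarrow> r \<le> h (\<^bold>\<box> \<phi>) \<rightarrow>\<^sub>G g \<phi>) \<and> (\<^bold>\<diamond> \<phi> \<in> \<Omega> \<longrightarrow> r \<le> g \<phi> \<rightarrow>\<^sub>G h (\<^bold>\<diamond> \<phi>)))"
    using r by auto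
  finally show ?thesis unfolding canonical_acc_def le_gimp_iff[OF r] .
qed

lemma canonical_acc_le_1: "finite \<Omega> \<Longrightarrow> canonical_acc \<Omega> h g \<le> 1"
  unfolding canonical_acc_def by (rule cInf_lower) auto

lemma min_canonical_acc_le:
  assumes "finite \<Omega>" "\<phi> \<in> \<Omega>"
  shows "\<^bold>\<box> \<phi> \<in> \<Omega> \<Longrightarrow> min (canonical_acc \<Omega> h g) (h (\<^bold>\<box> \<phi>)) \<le> g \<phi>"
    and "\<^bold>\<diamond> \<phi> \<in> \<Omega> \<Longrightarrow> min (canonical_acc \<Omega> h g) (g \<phi>) \<le> h (\<^bold>\<diamond> \<phi>)"
  using iffD1[OF le_canonical_acc_iff[OF assms(1) canonical_acc_le_1[OF assms(1)]] order_refl]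
    assms(2) by blast+

lemma godel_kripke_canonical_model:
  fixes \<Omega> :: "'v form set" and h :: "'v form \<Rightarrow> real"
  assumes "finite \<Omega>" "MG_hom h"
  shows "godel_kripke (canonical_model \<Omega>)"
proof -
  have "0 \<le> canonical_acc \<Omega> v w" if "MG_hom v" "MG_hom w" for v w
    unfolding le_canonical_acc_iff[OF assms(1) zero_le_one]
    using hom_bounds(1)[OF that(1)] hom_bounds(1)[OF that(2)] by (simp add: min.coboundedI1)
  then have "canonical_acc \<Omega> v w \<in> {0..1}" if "MG_hom v" "MG_hom w" for v w
    using canonical_acc_le_1[OF assms(1)] that by simp
  moreover have "v (PVar p) \<in> {0..1}" if "MG_hom v" for v :: "'v form \<Rightarrow> real" and p
    using hom_bounds[OF that] by simp
  ultimately show ?thesis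
    using assms(2) unfolding godel_kripke_def worlds_canonical_model
    by (auto simp: canonical_model_def simp del: atLeastAtMost_iff)
qed

lemma subformula_closed_args:
  assumes "subformula_closed \<Omega>"
  shows "\<phi> \<^bold>\<and> \<psi> \<in> \<Omega> \<Longrightarrow> \<phi> \<in> \<Omega> \<and> \<psi> \<in> \<Omega>" "\<phi> \<^bold>\<or> \<psi> \<in> \<Omega> \<Longrightarrow> \<phi> \<in> \<Omega> \<and> \<psi> \<in> \<Omega>"
    "\<phi> \<^bold>\<rightarrow> \<psi> \<in> \<Omega> \<Longrightarrow> \<phi> \<in> \<Omega> \<and> \<psi> \<in> \<Omega>" "\<^bold>\<box> \<phi> \<in> \<Omega> \<Longrightarrow> \<phi> \<in> \<Omega>" "\<^bold>\<diamond> \<phi> \<in> \<Omega> \<Longrightarrow> \<phi> \<in> \<Omega>"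
proof -
  have self: "\<chi> \<in> subforms \<chi>" for \<chi> :: "'a form" by (cases \<chi>) auto
  have sub: "subforms \<chi> \<subseteq> \<Omega>" if "\<chi> \<in> \<Omega>" for \<chi> using assms that by (simp add: subformula_closed_def)
  show "\<phi> \<^bold>\<and> \<psi> \<in> \<Omega> \<Longrightarrow> \<phi> \<in> \<Omega> \<and> \<psi> \<in> \<Omega>" "\<phi> \<^bold>\<or> \<psi> \<in> \<Omega> \<Longrightarrow> \<phi> \<in> \<Omega> \<and> \<psi> \<in> \<Omega>"
    "\<phi> \<^bold>\<rightarrow> \<psi> \<in> \<Omega> \<Longrightarrow> \<phi> \<in> \<Omega> \<and> \<psi> \<in> \<Omega>" "\<^bold>\<box> \<phi> \<in> \<Omega> \<Longrightarrow> \<phi> \<in> \<Omega>" "\<^bold>\<diamond> \<phi> \<in> \<Omega> \<Longrightarrow> \<phi> \<in> \<Omega>"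
    using sub[of "\<phi> \<^bold>\<and> \<psi>"] sub[of "\<phi> \<^bold>\<or> \<psi>"] sub[of "\<phi> \<^bold>\<rightarrow> \<psi>"] sub[of "\<^bold>\<box> \<phi>"] sub[of "\<^bold>\<diamond> \<phi>"]
      self[of \<phi>] self[of \<psi>] by auto
qed

text \<open>One inequality at each modality is built into the accessibility degree. The other needs
  actual successors, which \<open>box_successor\<close> provides up to an arbitrary bound and
  \<open>dia_successor\<close> exactly.\<close>

lemma canonical_truth:
  fixes \<Omega> :: "'v::countable form set"
  assumes \<Omega>: "finite \<Omega>" "subformula_closed \<Omega>"
  shows "MG_hom h \<Longrightarrow> \<psi> \<in> \<Omega> \<Longrightarrow> eval_form (canonical_model \<Omega>) h \<psi> = h \<psi>"
proof (induction \<psi> arbitrary: h)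
  case (PVar p)
  then show ?case by (simp add: canonical_model_def)
next
  case Fls
  then show ?case by (simp add: hom_Fls)
next
  case (Conj \<phi> \<psi>)
  then have "\<phi> \<in> \<Omega>" "\<psi> \<in> \<Omega>" using subformula_closed_args(1)[OF \<Omega>(2)] by blast+
  then show ?case using Conj by (simp add: MG_hom_def godel_hom_def)
next
  case (Disj \<phi> \<psi>)
  then have "\<phi> \<in> \<Omega>" "\<psi> \<in> \<Omega>" using subformula_closed_args(2)[OF \<Omega>(2)] by blast+
  then show ?case using Disj by (simp add: MG_hom_def godel_hom_def)
next
  case (Imp \<phi> \<psi>)
  then have "\<phi> \<in> \<Omega>" "\<psi> \<in> \<Omega>" using subformula_closed_args(3)[OF \<Omega>(2)] by blast+
  then show ?case using Imp by (simp add: MG_hom_def godel_hom_def)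
next
  case (Box \<phi>)
  let ?M = "canonical_model \<Omega>"
  have \<phi>: "\<phi> \<in> \<Omega>" by (rule subformula_closed_args(4)[OF \<Omega>(2) Box.prems(2)])
  have M: "godel_kripke ?M" by (rule godel_kripke_canonical_model[OF \<Omega>(1) Box.prems(1)])
  have h: "h \<in> worlds ?M" using Box.prems by (simp add: worlds_canonical_model)
  have acc: "acc ?M = canonical_acc \<Omega>" by (simp add: canonical_model_def)
  show ?case
  proof (rule antisym)
    show "h (\<^bold>\<box> \<phi>) \<le> eval_form ?M h (\<^bold>\<box> \<phi>)"
      unfolding eval_form_Box_iff[OF M h hom_bounds(2)[OF Box.prems(1)]] acc worlds_canonical_model
    proof
      fix w assume w: "w \<in> Collect (MG_hom :: ('v form \<Rightarrow> real) \<Rightarrow> bool)"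
      have "min (canonical_acc \<Omega> h w) (h (\<^bold>\<box> \<phi>)) \<le> w \<phi>"
        by (rule min_canonical_acc_le(1)[OF \<Omega>(1) \<phi> Box.prems(2)])
      then show "min (h (\<^bold>\<box> \<phi>)) (canonical_acc \<Omega> h w) \<le> eval_form ?M w \<phi>"
        using Box.IH[of w] w \<phi> by (simp add: min.commute)
    qed
    show "eval_form ?M h (\<^bold>\<box> \<phi>) \<le> h (\<^bold>\<box> \<phi>)"
    proof (rule ccontr)
      let ?\<beta> = "eval_form ?M h (\<^bold>\<box> \<phi>)"
      assume "\<not> ?\<beta> \<le> h (\<^bold>\<box> \<phi>)"
      then have lt: "h (\<^bold>\<box> \<phi>) < ?\<beta>" by simp
      have \<beta>: "?\<beta> \<le> 1" by (rule eval_form_bounds(2)[OF M h])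
      \<comment> \<open>The bound is the evaluated box value that is supposed too large. A world
        accessible to degree at least \<gamma> whose value at \<phi> is below \<gamma> contradicts
        it.\<close>
      obtain w \<gamma> where w: "MG_hom w" "\<gamma> \<le> ?\<beta>" "w \<phi> < \<gamma>"
        "\<And>\<psi>. \<psi> \<in> \<Omega> \<Longrightarrow> min \<gamma> (h (\<^bold>\<box> \<psi>)) \<le> w \<psi> \<and> min \<gamma> (w \<psi>) \<le> h (\<^bold>\<diamond> \<psi>)"
        by (rule box_successor[OF Box.prems(1) \<Omega>(1) lt \<beta>]) blast
      have "\<gamma> \<le> 1" using w(2) \<beta> by linarith
      then have "\<gamma> \<le> canonical_acc \<Omega> h w" using le_canonical_acc_iff[OF \<Omega>(1)] w(4) by blast
      moreover have "min ?\<beta> (acc ?M h w) \<le> eval_form ?M w \<phi>"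
        by (rule min_eval_form_Box_le[OF M h]) (simp add: worlds_canonical_model w(1))
      ultimately show False using w Box.IH[OF w(1) \<phi>] unfolding acc by linarith
    qed
  qed
next
  case (Dia \<phi>)
  let ?M = "canonical_model \<Omega>"
  have \<phi>: "\<phi> \<in> \<Omega>" by (rule subformula_closed_args(5)[OF \<Omega>(2) Dia.prems(2)])
  have M: "godel_kripke ?M" by (rule godel_kripke_canonical_model[OF \<Omega>(1) Dia.prems(1)])
  have h: "h \<in> worlds ?M" using Dia.prems by (simp add: worlds_canonical_model)
  have acc: "acc ?M = canonical_acc \<Omega>" by (simp add: canonical_model_def)
  show ?case
  proof (rule antisym)
    show "eval_form ?M h (\<^bold>\<diamond> \<phi>) \<le> h (\<^bold>\<diamond> \<phi>)"
      unfolding eval_form_Dia_iff[OF M h] acc worlds_canonical_model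
    proof
      fix w assume w: "w \<in> Collect (MG_hom :: ('v form \<Rightarrow> real) \<Rightarrow> bool)"
      have "min (canonical_acc \<Omega> h w) (w \<phi>) \<le> h (\<^bold>\<diamond> \<phi>)"
        by (rule min_canonical_acc_le(2)[OF \<Omega>(1) \<phi> Dia.prems(2)])
      then show "min (canonical_acc \<Omega> h w) (eval_form ?M w \<phi>) \<le> h (\<^bold>\<diamond> \<phi>)"
        using Dia.IH[of w] w \<phi> by simp
    qed
    obtain w where w: "MG_hom w" "h (\<^bold>\<diamond> \<phi>) \<le> w \<phi>"
      "\<And>\<psi>. \<psi> \<in> \<Omega> \<Longrightarrow> min (h (\<^bold>\<diamond> \<phi>)) (h (\<^bold>\<box> \<psi>)) \<le> w \<psi> \<and> min (h (\<^bold>\<diamond> \<phi>)) (w \<psi>) \<le> h (\<^bold>\<diamond> \<psi>)"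
      by (rule dia_successor[OF Dia.prems(1) \<Omega>(1)]) blast
    have "h (\<^bold>\<diamond> \<phi>) \<le> canonical_acc \<Omega> h w"
      using le_canonical_acc_iff[OF \<Omega>(1) hom_bounds(2)[OF Dia.prems(1)]] w(3) by blast
    moreover have "min (acc ?M h w) (eval_form ?M w \<phi>) \<le> eval_form ?M h (\<^bold>\<diamond> \<phi>)"
      by (rule min_le_eval_form_Dia[OF M h]) (simp add: worlds_canonical_model w(1))
    ultimately show "h (\<^bold>\<diamond> \<phi>) \<le> eval_form ?M h (\<^bold>\<diamond> \<phi>)"
      using w(2) Dia.IH[OF w(1) \<phi>] unfolding acc by linarith
  qed
qed

lemma canonical_model_dia_witnessed:
  fixes \<Omega> :: "'v::countable form set"
  assumes \<Omega>: "finite \<Omega>" "subformula_closed \<Omega>"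
  shows "dia_witnessed_on (canonical_model \<Omega>) \<Omega>"
  unfolding dia_witnessed_on_def worlds_canonical_model
proof (intro ballI allI impI)
  let ?M = "canonical_model \<Omega>"
  fix h :: "'v form \<Rightarrow> real" and \<phi> assume h\<phi>: "h \<in> Collect MG_hom" "\<^bold>\<diamond> \<phi> \<in> \<Omega>"
  have h: "MG_hom h" "h \<in> worlds ?M" using h\<phi> by (simp_all add: worlds_canonical_model)
  have M: "godel_kripke ?M" by (rule godel_kripke_canonical_model[OF \<Omega>(1) h(1)])
  have \<phi>: "\<phi> \<in> \<Omega>" by (rule subformula_closed_args(5)[OF \<Omega>(2) h\<phi>(2)])
  obtain w where w: "MG_hom w" "h (\<^bold>\<diamond> \<phi>) \<le> w \<phi>"
    "\<And>\<psi>. \<psi> \<in> \<Omega> \<Longrightarrow> min (h (\<^bold>\<diamond> \<phi>)) (h (\<^bold>\<box> \<psi>)) \<le> w \<psi> \<and> min (h (\<^bold>\<diamond> \<phi>)) (w \<psi>) \<le> h (\<^bold>\<diamond> \<psi>)"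
    by (rule dia_successor[OF h(1) \<Omega>(1)]) blast
  have "h (\<^bold>\<diamond> \<phi>) \<le> canonical_acc \<Omega> h w"
    using le_canonical_acc_iff[OF \<Omega>(1) hom_bounds(2)[OF h(1)]] w(3) by blast
  then have "h (\<^bold>\<diamond> \<phi>) \<le> min (acc ?M h w) (eval_form ?M w \<phi>)"
    using w(2) canonical_truth[OF \<Omega> w(1) \<phi>] by (simp add: canonical_model_def)
  moreover have "min (acc ?M h w) (eval_form ?M w \<phi>) \<le> eval_form ?M h (\<^bold>\<diamond> \<phi>)"
    by (rule min_le_eval_form_Dia[OF M h(2)]) (simp add: worlds_canonical_model w(1))
  ultimately show "\<exists>w\<in>Collect MG_hom. min (acc ?M h w) (eval_form ?M w \<phi>) = eval_form ?M h (\<^bold>\<diamond> \<phi>)"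
    using canonical_truth[OF \<Omega> h(1) h\<phi>(2)] w(1) by (intro bexI[of _ w]) auto
qed

section \<open>Tree models\<close>

text \<open>Only \<psi> has to lie in \<open>\<Omega>\<close>, not \<box> \<psi> or \<diamond>
  \<psi>, so that initial segments of an enumeration of all formulas can serve as
  \<open>\<Omega>\<close>.\<close>

definition successor_at ::
  "'v form set \<Rightarrow> ('v form \<Rightarrow> real) \<Rightarrow> ('v form \<Rightarrow> real) \<Rightarrow> real \<Rightarrow> bool" where
  "successor_at \<Omega> v w r \<longleftrightarrow> MG_hom w \<and> 0 \<le> r \<and> r \<le> 1 \<and>
     (\<forall>\<psi>\<in>\<Omega>. min r (v (\<^bold>\<box> \<psi>)) \<le> w \<psi> \<and> min r (w \<psi>) \<le> v (\<^bold>\<diamond> \<psi>))"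

lemma dia_successor_at:
  fixes v :: "'v::countable form \<Rightarrow> real"
  assumes "MG_hom v" "finite \<Omega>"
  shows "\<exists>w. successor_at \<Omega> v w (v (\<^bold>\<diamond> \<phi>)) \<and> v (\<^bold>\<diamond> \<phi>) \<le> w \<phi>"
proof (rule dia_successor[OF assms, of \<phi>])
  fix w assume "MG_hom w" "v (\<^bold>\<diamond> \<phi>) \<le> w \<phi>"
    "\<And>\<psi>. \<psi> \<in> \<Omega> \<Longrightarrow> min (v (\<^bold>\<diamond> \<phi>)) (v (\<^bold>\<box> \<psi>)) \<le> w \<psi> \<and> min (v (\<^bold>\<diamond> \<phi>)) (w \<psi>) \<le> v (\<^bold>\<diamond> \<psi>)"
  then show ?thesis using hom_bounds[OF assms(1)] unfolding successor_at_def by blast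
qed

lemma box_successor_at:
  fixes v :: "'v::countable form \<Rightarrow> real"
  assumes v: "MG_hom v" and \<Omega>: "finite \<Omega>" and \<beta>: "\<beta> \<le> 1"
  shows "\<exists>w \<gamma>. successor_at \<Omega> v w \<gamma> \<and> (v (\<^bold>\<box> \<phi>) < \<beta> \<longrightarrow> w \<phi> < \<gamma> \<and> w \<phi> < \<beta>)"
proof (cases "v (\<^bold>\<box> \<phi>) < \<beta>")
  case True
  show ?thesis
  proof (rule box_successor[OF v \<Omega> True \<beta>])
    fix w \<gamma> assume w: "MG_hom w" "0 \<le> \<gamma>" "\<gamma> \<le> \<beta>" "w \<phi> < \<gamma>"
      "\<And>\<psi>. \<psi> \<in> \<Omega> \<Longrightarrow> min \<gamma> (v (\<^bold>\<box> \<psi>)) \<le> w \<psi> \<and> min \<gamma> (w \<psi>) \<le> v (\<^bold>\<diamond> \<psi>)"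
    moreover have "\<gamma> \<le> 1" "w \<phi> < \<beta>" using w \<beta> by linarith+
    ultimately show ?thesis unfolding successor_at_def by blast
  qed
next
  case False
  \<comment> \<open>Nothing is asked of \<phi> here, but every name must be interpreted; at degree 0
    the homomorphism \<open>v\<close> is a successor of itself.\<close>
  have "successor_at \<Omega> v v 0"
    using v hom_bounds(1)[OF v] by (simp add: successor_at_def min.coboundedI1)
  then show ?thesis using False by blast
qed

text \<open>The world \<open>BoxChild n \<phi> m \<chi>\<close> is to bring the infimum that defines \<open>\<^bold>\<box> \<phi>\<close> at \<open>n\<close> below the
  truth value named \<open>(m, \<chi>)\<close>, if that value exceeds the one of \<open>\<^bold>\<box> \<phi>\<close>. Here \<open>(m, Some \<chi>)\<close> names
  the value of \<open>\<chi>\<close> at \<open>m\<close>, and \<open>(m, None)\<close> the degree to which \<open>m\<close> is accessible from its parent.\<close>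

datatype 'v world_name =
    Root
  | DiaChild "'v world_name" "'v form"
  | BoxChild "'v world_name" "'v form" "'v world_name" "'v form option"

instance world_name :: (countable) countable
  by countable_datatype

primrec parent :: "'v world_name \<Rightarrow> 'v world_name option" where
  "parent Root = None"
| "parent (DiaChild n \<phi>) = Some n"
| "parent (BoxChild n \<phi> m \<chi>) = Some n"

primrec named_value :: "('v form \<Rightarrow> real) \<times> real \<Rightarrow> 'v form option \<Rightarrow> real" where
  "named_value p None = snd p"
| "named_value p (Some \<phi>) = fst p \<phi>"

text \<open>The bound of a box child is a value at a name that occurs inside the name of the child,
  so it is available when the child is chosen. Names do not depend on \<open>\<Omega>\<close>, so
  interpretations over different finite sets give values to the same names. The degree 0 at
  \<open>Root\<close> is a dummy, as \<open>Root\<close> has no parent.\<close>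

primrec interp ::
  "'v form set \<Rightarrow> ('v form \<Rightarrow> real) \<Rightarrow> 'v world_name \<Rightarrow> ('v form \<Rightarrow> real) \<times> real" where
  "interp \<Omega> h Root = (h, 0)"
| "interp \<Omega> h (DiaChild n \<phi>) =
    (let v = fst (interp \<Omega> h n)
     in (SOME w. successor_at \<Omega> v w (v (\<^bold>\<diamond> \<phi>)) \<and> v (\<^bold>\<diamond> \<phi>) \<le> w \<phi>, v (\<^bold>\<diamond> \<phi>)))"
| "interp \<Omega> h (BoxChild n \<phi> m \<chi>) =
    (let v = fst (interp \<Omega> h n); \<beta> = named_value (interp \<Omega> h m) \<chi>
     in SOME p. successor_at \<Omega> v (fst p) (snd p) \<and>
       (v (\<^bold>\<box> \<phi>) < \<beta> \<longrightarrow> fst p \<phi> < snd p \<and> fst p \<phi> < \<beta>))"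

section \<open>Interpretation of the names over one finite set\<close>

context
  fixes h :: "'v::countable form \<Rightarrow> real" and \<Omega> :: "'v form set"
  assumes h: "MG_hom h" and \<Omega>: "finite \<Omega>"
begin

lemma interp_DiaChild:
  assumes "MG_hom (fst (interp \<Omega> h n))"
  shows "successor_at \<Omega> (fst (interp \<Omega> h n)) (fst (interp \<Omega> h (DiaChild n \<phi>)))
      (snd (interp \<Omega> h (DiaChild n \<phi>)))"
    and "snd (interp \<Omega> h (DiaChild n \<phi>)) = fst (interp \<Omega> h n) (\<^bold>\<diamond> \<phi>)"
    and "fst (interp \<Omega> h n) (\<^bold>\<diamond> \<phi>) \<le> fst (interp \<Omega> h (DiaChild n \<phi>)) \<phi>"
  using someI_ex[OF dia_successor_at[OF assms \<Omega>, of \<phi>]] by (simp_all add: Let_def)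

lemma interp_BoxChild:
  assumes "MG_hom (fst (interp \<Omega> h n))" and "named_value (interp \<Omega> h m) \<chi> \<le> 1"
  shows "successor_at \<Omega> (fst (interp \<Omega> h n)) (fst (interp \<Omega> h (BoxChild n \<phi> m \<chi>)))
      (snd (interp \<Omega> h (BoxChild n \<phi> m \<chi>)))"
    and "fst (interp \<Omega> h n) (\<^bold>\<box> \<phi>) < named_value (interp \<Omega> h m) \<chi> \<Longrightarrow>
      fst (interp \<Omega> h (BoxChild n \<phi> m \<chi>)) \<phi> < snd (interp \<Omega> h (BoxChild n \<phi> m \<chi>)) \<and>
      fst (interp \<Omega> h (BoxChild n \<phi> m \<chi>)) \<phi> < named_value (interp \<Omega> h m) \<chi>"
proof -
  let ?v = "fst (interp \<Omega> h n)" and ?\<beta> = "named_value (interp \<Omega> h m) \<chi>"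
  have "\<exists>p. successor_at \<Omega> ?v (fst p) (snd p) \<and>
      (?v (\<^bold>\<box> \<phi>) < ?\<beta> \<longrightarrow> fst p \<phi> < snd p \<and> fst p \<phi> < ?\<beta>)"
    using box_successor_at[OF assms(1) \<Omega> assms(2), of \<phi>] by (simp only: split_paired_Ex fst_conv snd_conv)
  note p = someI_ex[OF this]
  show "successor_at \<Omega> ?v (fst (interp \<Omega> h (BoxChild n \<phi> m \<chi>)))
      (snd (interp \<Omega> h (BoxChild n \<phi> m \<chi>)))"
    using p by (simp add: Let_def)
  show "fst (interp \<Omega> h (BoxChild n \<phi> m \<chi>)) \<phi> < snd (interp \<Omega> h (BoxChild n \<phi> m \<chi>)) \<and>
      fst (interp \<Omega> h (BoxChild n \<phi> m \<chi>)) \<phi> < ?\<beta>" if "?v (\<^bold>\<box> \<phi>) < ?\<beta>"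
    using p that by (simp add: Let_def)
qed

lemma interp_hom: "MG_hom (fst (interp \<Omega> h n)) \<and> snd (interp \<Omega> h n) \<in> {0..1}"
proof (induction n)
  case Root
  show ?case using h by simp
next
  case (DiaChild n \<phi>)
  then show ?case using interp_DiaChild(1)[of n \<phi>] unfolding successor_at_def by simp
next
  case (BoxChild n \<phi> m \<chi>)
  then have "named_value (interp \<Omega> h m) \<chi> \<le> 1" using hom_bounds(2) by (cases \<chi>) auto
  then show ?case
    using interp_BoxChild(1)[of n m \<chi> \<phi>] BoxChild unfolding successor_at_def by simp
qed

lemma named_value_interp_bounds: "named_value (interp \<Omega> h n) \<chi> \<in> {0..1}"
  using interp_hom[of n] hom_bounds[of "fst (interp \<Omega> h n)"] by (cases \<chi>) simp_all

lemma interp_parent: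
  assumes "parent w = Some n"
  shows "successor_at \<Omega> (fst (interp \<Omega> h n)) (fst (interp \<Omega> h w)) (snd (interp \<Omega> h w))"
proof (cases w)
  case (DiaChild n' \<phi>)
  then show ?thesis using assms interp_DiaChild(1) interp_hom by simp
next
  case (BoxChild n' \<phi> m \<chi>)
  then show ?thesis
    using assms interp_BoxChild(1)[of n m \<chi> \<phi>] interp_hom named_value_interp_bounds[of m \<chi>] by simp
qed (use assms in simp)

end

section \<open>The limit tree\<close>

text \<open>For fixed names and formulas, each property other than the one for box infima is a
  condition on the order of finitely many named values, so it passes from a late enough stage to the
  limit. The bound \<open>c\<close> for boxes is an arbitrary real, which is where the infimum
  clause of \<open>order_limit\<close> enters.\<close>

lemma limit_tree_exists:
  fixes h :: "'v::countable form \<Rightarrow> real"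
  assumes h: "MG_hom h"
  obtains e :: "'v world_name \<Rightarrow> 'v form \<Rightarrow> real" and r :: "'v world_name \<Rightarrow> real" where
    "\<And>n. godel_hom (e n)" "\<And>n. r n \<in> {0..1}"
    "\<And>w n \<psi>. parent w = Some n \<Longrightarrow> min (r w) (e n (\<^bold>\<box> \<psi>)) \<le> e w \<psi>"
    "\<And>w n \<psi>. parent w = Some n \<Longrightarrow> min (r w) (e w \<psi>) \<le> e n (\<^bold>\<diamond> \<psi>)"
    "\<And>n \<phi>. r (DiaChild n \<phi>) = e n (\<^bold>\<diamond> \<phi>)" "\<And>n \<phi>. e n (\<^bold>\<diamond> \<phi>) \<le> e (DiaChild n \<phi>) \<phi>"
    "\<And>n \<phi> c. e n (\<^bold>\<box> \<phi>) < c \<Longrightarrow> e n (\<^bold>\<box> \<phi>) < 1 \<Longrightarrow>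
      \<exists>w. parent w = Some n \<and> e w \<phi> < r w \<and> e w \<phi> < c"
    "\<And>\<phi>. e Root \<phi> = 1 \<longleftrightarrow> h \<phi> = 1"
proof -
  define \<Omega> :: "nat \<Rightarrow> 'v form set" where "\<Omega> k = from_nat ` {..k}" for k
  have fin\<Omega>: "finite (\<Omega> k)" for k by (simp add: \<Omega>_def)
  have \<Omega>: "\<psi> \<in> \<Omega> k" if "to_nat \<psi> \<le> k" for \<psi> k
    unfolding \<Omega>_def using that by (intro image_eqI[of _ _ "to_nat \<psi>"]) auto
  define i where "i k n = interp (\<Omega> k) h n" for k n
  define H where "H k x = named_value (i k (fst x)) (snd x)" for k and x :: "'v world_name \<times> 'v form option"
  \<comment> \<open>\<open>b\<close> and \<open>t\<close> are names whose values are 0 and 1 at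
    every stage, the common endpoints of all the orders.\<close>
  define b :: "'v world_name \<times> 'v form option" where "b = (Root, Some \<^bold>\<bottom>)"
  define t :: "'v world_name \<times> 'v form option" where "t = (Root, Some (\<^bold>\<not> \<^bold>\<bottom>))"
  have hom: "MG_hom (fst (i k n))" for k n
    using interp_hom[OF h fin\<Omega>] by (simp add: i_def)
  have ghom: "godel_hom (fst (i k n))" for k n using hom by (simp add: MG_hom_def)
  have range: "H k x \<in> {0..1}" for k x
    unfolding H_def i_def by (rule named_value_interp_bounds[OF h fin\<Omega>])
  have hb: "H k b = 0" for k by (simp add: H_def b_def i_def hom_Fls[OF h])
  have ht: "H k t = 1" for k by (simp add: H_def t_def i_def hom_Imp[OF h] gimp_def)
  show thesis
  proof (rule order_limit[of H b t, OF range hb ht])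
    fix f :: "'v world_name \<times> 'v form option \<Rightarrow> real"
    assume f: "\<And>x. f x \<in> {0..1}" "f b = 0" "f t = 1"
      and f_ord: "\<And>Y K. finite Y \<Longrightarrow> \<exists>k\<ge>K. \<forall>x\<in>Y. \<forall>y\<in>Y. f x \<le> f y \<longleftrightarrow> H k x \<le> H k y"
      and f_inf: "\<And>x c. f x < c \<Longrightarrow> f x < 1 \<Longrightarrow> \<exists>y. f x < f y \<and> (\<forall>s. f s < f y \<longrightarrow> f s < c)"
    define agree where "agree k Y \<longleftrightarrow> (\<forall>x\<in>Y. \<forall>y\<in>Y. f x \<le> f y \<longleftrightarrow> H k x \<le> H k y) \<and>
        (\<forall>x\<in>Y. \<forall>y\<in>Y. f x < f y \<longleftrightarrow> H k x < H k y) \<and> (\<forall>x\<in>Y. \<forall>y\<in>Y. f x = f y \<longleftrightarrow> H k x = H k y)"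
      for k Y
    have agree_ex: "\<exists>k\<ge>K. agree k Y" if Y: "finite Y" for Y K
    proof -
      obtain k where k: "k \<ge> K" "\<forall>x\<in>Y. \<forall>y\<in>Y. f x \<le> f y \<longleftrightarrow> H k x \<le> H k y"
        using f_ord[OF Y] by blast
      have "(f x < f y \<longleftrightarrow> H k x < H k y) \<and> (f x = f y \<longleftrightarrow> H k x = H k y)" if "x \<in> Y" "y \<in> Y" for x y
      proof -
        have "f x \<le> f y \<longleftrightarrow> H k x \<le> H k y" "f y \<le> f x \<longleftrightarrow> H k y \<le> H k x" using k(2) that by blast+
        then show ?thesis by (cases "f x \<le> f y"; cases "f y \<le> f x") auto
      qed
      then have "agree k Y" using k(2) unfolding agree_def by simp
      then show ?thesis using k(1) by blast
    qed
    define e where "e n \<phi> = f (n, Some \<phi>)" for n \<phi>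
    define r where "r n = f (n, None)" for n
    have H_e: "H k (n, Some \<phi>) = fst (i k n) \<phi>" and H_r: "H k (n, None) = snd (i k n)" for k n \<phi>
      by (simp_all add: H_def)
    show thesis
    proof (rule that[of e r])
      fix n
      show "r n \<in> {0..1}" unfolding r_def by (rule f)
      have "e n \<phi> \<in> {0..1}" for \<phi> unfolding e_def by (rule f)
      moreover have "e n \<^bold>\<bottom> = 0"
      proof -
        obtain k where "agree k {(n, Some \<^bold>\<bottom>), b}" using agree_ex[of "{(n, Some \<^bold>\<bottom>), b}"] by auto
        then have "f (n, Some \<^bold>\<bottom>) = f b \<longleftrightarrow> H k (n, Some \<^bold>\<bottom>) = H k b" by (simp add: agree_def)
        then have "f (n, Some \<^bold>\<bottom>) = f b" using hb[of k] ghom[of k n] by (simp add: H_e godel_hom_def)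
        then show ?thesis using f by (simp add: e_def)
      qed
      moreover have "e n (\<phi> \<^bold>\<and> \<psi>) = min (e n \<phi>) (e n \<psi>)" for \<phi> \<psi>
      proof -
        let ?Y = "{(n, Some \<phi>), (n, Some \<psi>), (n, Some (\<phi> \<^bold>\<and> \<psi>))}"
        obtain k where k: "agree k ?Y" using agree_ex[of ?Y] by auto
        have "H k (n, Some (\<phi> \<^bold>\<and> \<psi>)) = min (H k (n, Some \<phi>)) (H k (n, Some \<psi>))"
          using ghom[of k n] by (simp add: H_e godel_hom_def)
        then show ?thesis using k by (simp add: agree_def e_def min_def split: if_splits)
      qed
      moreover have "e n (\<phi> \<^bold>\<or> \<psi>) = max (e n \<phi>) (e n \<psi>)" for \<phi> \<psi>
      proof -
        let ?Y = "{(n, Some \<phi>), (n, Some \<psi>), (n, Some (\<phi> \<^bold>\<or> \<psi>))}"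
        obtain k where k: "agree k ?Y" using agree_ex[of ?Y] by auto
        have "H k (n, Some (\<phi> \<^bold>\<or> \<psi>)) = max (H k (n, Some \<phi>)) (H k (n, Some \<psi>))"
          using ghom[of k n] by (simp add: H_e godel_hom_def)
        then show ?thesis using k by (simp add: agree_def e_def max_def split: if_splits)
      qed
      moreover have "e n (\<phi> \<^bold>\<rightarrow> \<psi>) = e n \<phi> \<rightarrow>\<^sub>G e n \<psi>" for \<phi> \<psi>
      proof -
        \<comment> \<open>\<open>t\<close> is included because an implication may take the value 1,
          which must be a named value to be compared.\<close>
        let ?Y = "{(n, Some \<phi>), (n, Some \<psi>), (n, Some (\<phi> \<^bold>\<rightarrow> \<psi>)), t}"
        obtain k where k: "agree k ?Y" using agree_ex[of ?Y] by auto
        have "H k (n, Some (\<phi> \<^bold>\<rightarrow> \<psi>)) =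
            (if H k (n, Some \<phi>) \<le> H k (n, Some \<psi>) then H k t else H k (n, Some \<psi>))"
          using ghom[of k n] ht[of k] by (simp add: H_e godel_hom_def gimp_def)
        then have "f (n, Some (\<phi> \<^bold>\<rightarrow> \<psi>)) =
            (if f (n, Some \<phi>) \<le> f (n, Some \<psi>) then f t else f (n, Some \<psi>))"
          using k by (simp add: agree_def split: if_splits)
        then show ?thesis using f(3) by (simp add: e_def gimp_def)
      qed
      ultimately show "godel_hom (e n)" unfolding godel_hom_def by blast
    next
      fix w n :: "'v world_name" and \<psi> assume w: "parent w = Some n"
      have *: "(r w \<le> e w \<psi> \<or> e n (\<^bold>\<box> \<psi>) \<le> e w \<psi>) \<and> (r w \<le> e n (\<^bold>\<diamond> \<psi>) \<or> e w \<psi> \<le> e n (\<^bold>\<diamond> \<psi>))"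
      proof -
        let ?Y = "{(w, None), (w, Some \<psi>), (n, Some (\<^bold>\<box> \<psi>)), (n, Some (\<^bold>\<diamond> \<psi>))}"
        \<comment> \<open>The stage must be late enough to have \<psi> in \<open>\<Omega> k\<close>.
          The inequalities with minima are split into disjunctions of plain comparisons, which
          transfer.\<close>
        obtain k where k: "k \<ge> to_nat \<psi>" "agree k ?Y" using agree_ex[of ?Y "to_nat \<psi>"] by auto
        have "successor_at (\<Omega> k) (fst (i k n)) (fst (i k w)) (snd (i k w))"
          unfolding i_def by (rule interp_parent[OF h fin\<Omega> w])
        then have "min (H k (w, None)) (H k (n, Some (\<^bold>\<box> \<psi>))) \<le> H k (w, Some \<psi>)"
          "min (H k (w, None)) (H k (w, Some \<psi>)) \<le> H k (n, Some (\<^bold>\<diamond> \<psi>))"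
          using \<Omega>[OF k(1)] by (auto simp: successor_at_def H_e H_r)
        then show ?thesis using k(2) by (simp add: agree_def e_def r_def min_le_iff_disj)
      qed
      then show "min (r w) (e n (\<^bold>\<box> \<psi>)) \<le> e w \<psi>" "min (r w) (e w \<psi>) \<le> e n (\<^bold>\<diamond> \<psi>)"
        by (auto simp: min_le_iff_disj)
    next
      fix n :: "'v world_name" and \<phi>
      let ?w = "DiaChild n \<phi>"
      let ?Y = "{(?w, None), (?w, Some \<phi>), (n, Some (\<^bold>\<diamond> \<phi>))}"
      obtain k where k: "agree k ?Y" using agree_ex[of ?Y] by auto
      have "H k (?w, None) = H k (n, Some (\<^bold>\<diamond> \<phi>))" "H k (n, Some (\<^bold>\<diamond> \<phi>)) \<le> H k (?w, Some \<phi>)"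
        unfolding H_e H_r i_def by (rule interp_DiaChild(2,3)[OF h fin\<Omega> hom[unfolded i_def]])+
      moreover have "f (?w, None) = f (n, Some (\<^bold>\<diamond> \<phi>)) \<longleftrightarrow> H k (?w, None) = H k (n, Some (\<^bold>\<diamond> \<phi>))"
        "f (n, Some (\<^bold>\<diamond> \<phi>)) \<le> f (?w, Some \<phi>) \<longleftrightarrow> H k (n, Some (\<^bold>\<diamond> \<phi>)) \<le> H k (?w, Some \<phi>)"
        using k unfolding agree_def by blast+
      ultimately show "r ?w = e n (\<^bold>\<diamond> \<phi>)" "e n (\<^bold>\<diamond> \<phi>) \<le> e ?w \<phi>"
        unfolding e_def r_def by blast+
    next
      fix n :: "'v world_name" and \<phi> c assume c: "e n (\<^bold>\<box> \<phi>) < c" "e n (\<^bold>\<box> \<phi>) < 1"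
      \<comment> \<open>The real \<open>c\<close> is replaced by a named value \<open>y\<close> such
        that everything below \<open>y\<close> is below \<open>c\<close>. The box child aimed at
        \<open>y\<close> falls below \<open>y\<close> at the chosen stage, hence in the
        limit.\<close>
      then obtain y where y: "f (n, Some (\<^bold>\<box> \<phi>)) < f y" "\<forall>s. f s < f y \<longrightarrow> f s < c"
        using f_inf[of "(n, Some (\<^bold>\<box> \<phi>))" c] unfolding e_def by blast
      let ?w = "BoxChild n \<phi> (fst y) (snd y)"
      let ?Y = "{(n, Some (\<^bold>\<box> \<phi>)), y, (?w, None), (?w, Some \<phi>)}"
      obtain k where k: "agree k ?Y" using agree_ex[of ?Y] by auto
      have "H k (n, Some (\<^bold>\<box> \<phi>)) < H k y" using k y(1) by (simp add: agree_def)
      then have "H k (?w, Some \<phi>) < H k (?w, None) \<and> H k (?w, Some \<phi>) < H k y"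
        using interp_BoxChild(2)[OF h fin\<Omega> hom[unfolded i_def, of k n], of "fst y" "snd y" \<phi>]
          range[of k y] unfolding H_def i_def by (simp del: interp.simps)
      then have "f (?w, Some \<phi>) < f (?w, None)" "f (?w, Some \<phi>) < f y"
        using k by (simp_all add: agree_def)
      then show "\<exists>w. parent w = Some n \<and> e w \<phi> < r w \<and> e w \<phi> < c"
        using y(2) by (intro exI[of _ ?w]) (simp add: e_def r_def)
    next
      fix \<phi>
      let ?Y = "{(Root, Some \<phi>), t}"
      obtain k where "agree k ?Y" using agree_ex[of ?Y] by auto
      then have "f (Root, Some \<phi>) = f t \<longleftrightarrow> H k (Root, Some \<phi>) = H k t" by (simp add: agree_def)
      then show "e Root \<phi> = 1 \<longleftrightarrow> h \<phi> = 1" using f(3) ht[of k] by (simp add: e_def H_e i_def)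
    qed
  qed
qed

section \<open>From the limit tree to strong completeness\<close>

text \<open>Accessibility is \<open>r\<close> along the edges of the tree and 0 elsewhere. Box
  children drive the infima down to the required values, and \<open>DiaChild\<close> attains the
  supremum for every node and formula, so the model is witnessed without restriction.\<close>

lemma tree_model_exists:
  fixes h :: "'v::countable form \<Rightarrow> real"
  assumes "MG_hom h"
  obtains M :: "('v form \<Rightarrow> real, 'v) kripke" and v where
    "M \<in> dia_witnessed_models" "v \<in> worlds M" "\<And>\<phi>. eval_form M v \<phi> = 1 \<longleftrightarrow> h \<phi> = 1"
proof (rule limit_tree_exists[OF assms])
  fix e :: "'v world_name \<Rightarrow> 'v form \<Rightarrow> real" and r :: "'v world_name \<Rightarrow> real"
  assume e: "\<And>n. godel_hom (e n)" and r: "\<And>n. r n \<in> {0..1}"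
    and box: "\<And>w n \<psi>. parent w = Some n \<Longrightarrow> min (r w) (e n (\<^bold>\<box> \<psi>)) \<le> e w \<psi>"
    and dia: "\<And>w n \<psi>. parent w = Some n \<Longrightarrow> min (r w) (e w \<psi>) \<le> e n (\<^bold>\<diamond> \<psi>)"
    and wit: "\<And>n \<phi>. r (DiaChild n \<phi>) = e n (\<^bold>\<diamond> \<phi>)" "\<And>n \<phi>. e n (\<^bold>\<diamond> \<phi>) \<le> e (DiaChild n \<phi>) \<phi>"
    and inf: "\<And>n \<phi> c. e n (\<^bold>\<box> \<phi>) < c \<Longrightarrow> e n (\<^bold>\<box> \<phi>) < 1 \<Longrightarrow>
      \<exists>w. parent w = Some n \<and> e w \<phi> < r w \<and> e w \<phi> < c"
    and root: "\<And>\<phi>. e Root \<phi> = 1 \<longleftrightarrow> h \<phi> = 1"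
  \<comment> \<open>The model has to live on the type of the canonical worlds, so names are encoded
    there as constant functions; any injection would do.\<close>
  define tw :: "'v world_name \<Rightarrow> 'v form \<Rightarrow> real" where "tw n = (\<lambda>_. real (to_nat n))" for n
  have "inj tw" unfolding tw_def by (intro injI) (auto dest: fun_cong)
  then have inv: "inv tw (tw n) = n" for n by (rule inv_f_f)
  define M :: "('v form \<Rightarrow> real, 'v) kripke" where
    "M = \<lparr> worlds = range tw,
      acc = (\<lambda>v w. if parent (inv tw w) = Some (inv tw v) then r (inv tw w) else 0),
      atom_val = (\<lambda>v p. e (inv tw v) (PVar p)) \<rparr>"
  have W: "worlds M = range tw" by (simp add: M_def)
  have acc: "acc M (tw n) (tw m) = (if parent m = Some n then r m else 0)" for n m
    by (simp add: M_def inv)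
  have eb: "0 \<le> e n \<phi>" "e n \<phi> \<le> 1" for n \<phi> using e[of n] by (auto simp: godel_hom_def)
  have GK: "godel_kripke M"
    unfolding godel_kripke_def
  proof (intro conjI ballI allI)
    show "worlds M \<noteq> {}" by (simp add: W)
    fix v w p assume "v \<in> worlds M" "w \<in> worlds M"
    then obtain n m where "v = tw n" "w = tw m" by (auto simp: W)
    then show "acc M v w \<in> {0..1}" using r[of m] by (simp add: acc)
  next
    fix v p assume "v \<in> worlds M"
    then obtain n where "v = tw n" by (auto simp: W)
    then show "atom_val M v p \<in> {0..1}" using eb by (simp add: M_def inv)
  qed
  have truth: "eval_form M (tw n) \<phi> = e n \<phi>" for n \<phi>
  proof (induction \<phi> arbitrary: n)
    case (PVar p) show ?case by (simp add: M_def inv)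
  next
    case (Box \<phi>)
    have n: "tw n \<in> worlds M" by (simp add: W)
    show ?case
    proof (rule antisym)
      show "e n (\<^bold>\<box> \<phi>) \<le> eval_form M (tw n) (\<^bold>\<box> \<phi>)"
        unfolding eval_form_Box_iff[OF GK n eb(2)] W
      proof
        fix v assume "v \<in> range tw"
        then obtain w where v: "v = tw w" by blast
        show "min (e n (\<^bold>\<box> \<phi>)) (acc M (tw n) v) \<le> eval_form M v \<phi>"
          using box[of w n \<phi>] eb(1)[of w \<phi>]
          by (simp add: v acc Box.IH min_le_iff_disj disj_commute)
      qed
      show "eval_form M (tw n) (\<^bold>\<box> \<phi>) \<le> e n (\<^bold>\<box> \<phi>)"
      proof (rule ccontr)
        assume "\<not> ?thesis"
        then have lt: "e n (\<^bold>\<box> \<phi>) < eval_form M (tw n) (\<^bold>\<box> \<phi>)" by simp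
        then have "e n (\<^bold>\<box> \<phi>) < 1" using eval_form_bounds(2)[OF GK n] by (rule less_le_trans)
        then obtain w where w: "parent w = Some n" "e w \<phi> < r w"
            "e w \<phi> < eval_form M (tw n) (\<^bold>\<box> \<phi>)"
          using inf[OF lt] by blast
        have "min (eval_form M (tw n) (\<^bold>\<box> \<phi>)) (acc M (tw n) (tw w)) \<le> eval_form M (tw w) \<phi>"
          by (rule min_eval_form_Box_le[OF GK n]) (simp add: W)
        then show False using w by (simp add: acc Box.IH min_le_iff_disj del: eval_form.simps)
      qed
    qed
  next
    case (Dia \<phi>)
    have n: "tw n \<in> worlds M" by (simp add: W)
    show ?case
    proof (rule antisym)
      show "eval_form M (tw n) (\<^bold>\<diamond> \<phi>) \<le> e n (\<^bold>\<diamond> \<phi>)"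
        unfolding eval_form_Dia_iff[OF GK n] W
      proof
        fix v assume "v \<in> range tw"
        then obtain w where v: "v = tw w" by blast
        show "min (acc M (tw n) v) (eval_form M v \<phi>) \<le> e n (\<^bold>\<diamond> \<phi>)"
          using dia[of w n \<phi>] eb(1)[of n "\<^bold>\<diamond> \<phi>"]
          by (simp add: v acc Dia.IH min_le_iff_disj)
      qed
      have "min (acc M (tw n) (tw (DiaChild n \<phi>))) (eval_form M (tw (DiaChild n \<phi>)) \<phi>)
          \<le> eval_form M (tw n) (\<^bold>\<diamond> \<phi>)"
        by (rule min_le_eval_form_Dia[OF GK n]) (simp add: W)
      then show "e n (\<^bold>\<diamond> \<phi>) \<le> eval_form M (tw n) (\<^bold>\<diamond> \<phi>)"
        using wit[where n = n and \<phi> = \<phi>] by (simp add: acc Dia.IH min_absorb1 del: eval_form.simps)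
    qed
  qed (use e in \<open>simp_all add: godel_hom_def\<close>)
  have "dia_witnessed_on M UNIV"
    unfolding dia_witnessed_on_def W
  proof (intro ballI allI impI)
    fix v \<phi> assume "v \<in> range tw"
    then obtain n where v: "v = tw n" by blast
    have "min (acc M v (tw (DiaChild n \<phi>))) (eval_form M (tw (DiaChild n \<phi>)) \<phi>)
        = eval_form M v (\<^bold>\<diamond> \<phi>)"
      using wit[where n = n and \<phi> = \<phi>]
      by (simp add: v acc truth min_absorb1 del: eval_form.simps)
    then show "\<exists>w\<in>range tw. min (acc M v w) (eval_form M w \<phi>) = eval_form M v (\<^bold>\<diamond> \<phi>)" by blast
  qed
  then have "M \<in> dia_witnessed_models" using GK by (simp add: dia_witnessed_models_def)
  then show thesis
    by (rule that[of M "tw Root"]) (simp_all add: W truth root)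
qed

text \<open>The consequences of \<open>\<Gamma>\<close> are separated from the formulas that imply
  \<phi> over \<open>\<Gamma>\<close>. The root of the tree need only agree with the separating
  homomorphism on which formulas have the value 1, since local consequence looks at nothing
  else.\<close>

lemma entails_imp_MG_derives:
  fixes \<Gamma> :: "'v::countable form set"
  assumes ent: "entails (dia_witnessed_models :: ('v form \<Rightarrow> real, 'v) kripke set) \<Gamma> \<phi>"
  shows "MG_derives \<Gamma> \<phi>"
proof (rule ccontr)
  assume neg: "\<not> MG_derives \<Gamma> \<phi>"
  define T where "T = {\<psi>. MG_derives \<Gamma> \<psi>}"
  define D where "D = {\<delta>. \<delta> \<^bold>\<rightarrow> \<phi> \<in> T}"
  have T: "MG_theory T" unfolding T_def by (rule MG_theory_Collect_derives)
  have disj: "\<delta> \<^bold>\<or> \<epsilon> \<in> D" if "\<delta> \<in> D" "\<epsilon> \<in> D" for \<delta> \<epsilon>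
    using theory_disjE[OF T, of \<delta> \<phi> \<epsilon>] that by (simp add: D_def)
  have "\<phi> \<notin> T" using neg by (simp add: T_def)
  then have sep: "T \<inter> D = {}" using theory_mp[OF T] by (auto simp: D_def)
  have \<phi>: "\<phi> \<in> D" using theory_refl[OF T] by (simp add: D_def)
  obtain h where h: "MG_hom h" "\<And>\<psi>. \<psi> \<in> T \<Longrightarrow> h \<psi> = 1" "\<And>\<delta>. \<delta> \<in> D \<Longrightarrow> h \<delta> < 1"
    using separating_hom_exists[OF T disj sep] \<phi> by blast
  obtain M :: "('v form \<Rightarrow> real, 'v) kripke" and v where
    M: "M \<in> dia_witnessed_models" "v \<in> worlds M" "\<And>\<psi>. eval_form M v \<psi> = 1 \<longleftrightarrow> h \<psi> = 1"
    by (rule tree_model_exists[OF h(1)]) blast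
  have "\<forall>\<gamma>\<in>\<Gamma>. eval_form M v \<gamma> = 1" by (simp add: M(3) h(2) T_def MG_derives.Assm)
  then have "eval_form M v \<phi> = 1" using ent M(1,2) unfolding entails_def by blast
  then show False using M(3) h(3)[OF \<phi>] by simp
qed

lemma MG_derives_imp_entails:
  "MG_derives \<Gamma> \<phi> \<Longrightarrow> entails dia_witnessed_models \<Gamma> \<phi>"
  by (simp add: entails_def dia_witnessed_models_def MG_derives_sound)

theorem theorem1:
  shows "complete_wrt (MG_derives :: 'v::countable form set \<Rightarrow> 'v form \<Rightarrow> bool)
           (dia_witnessed_models :: ('v form \<Rightarrow> real, 'v) kripke set) \<and>
         (\<forall>(\<Gamma> :: 'v form set) \<phi>. MG_derives \<Gamma> \<phi> \<longrightarrow>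
           entails (dia_witnessed_models :: ('w, 'v) kripke set) \<Gamma> \<phi>) \<and>
         (\<forall>\<Omega> :: 'v form set. finite \<Omega> \<and> subformula_closed \<Omega> \<longrightarrow>
           dia_witnessed_on (canonical_model \<Omega>) \<Omega>)"
  unfolding complete_wrt_def
  by (intro conjI allI impI iffI)
    (simp_all add: entails_imp_MG_derives MG_derives_imp_entails canonical_model_dia_witnessed)

end
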